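(* There is a canonical way to associate to a solution $u_1$ of a stationary $g$-KdV equation $r_g[u_1]+\sum_{k=0}^{g-2}a_kr_k[u_1]=0$ a hyperelliptic curve $$\Gamma=\{(\xi,y)\in\mathbb C^2\mid y^2=4\mu(\xi)\},\qquad \mu(\xi)=4\xi^{-1}+\sum_{i=1}^{2g}\mu_i\xi^i ,$$ with constants $\mu_i$. Namely, let $\mu_1,\dots,\mu_{g-1}$ be given by $$\mu_k=8a_{g-k-1}+4\sum_{i=1}^{k-2}a_{g-i-1}a_{g-k+i},\qquad k=1,\dots,g-1,$$ and let $u_2,\dots,u_g$ be the differential polynomials in $u_1$ determined from $\mu_1,\dots,\mu_{g-1}$ as described in the context. Then, with $\mathbf u(\xi)=\sum_{i=1}^gu_i\xi^i$, $$4\mu(\xi)=\mathbf u'(\xi)^2+2\mathbf u''(\xi)(2-\mathbf u(\xi))+4(\xi^{-1}+u_1)(2-\mathbf u(\xi))^2$$ holds with constants $\mu_g,\dots,\mu_{2g}$, and these are found by evaluating the right-hand side at any one point $t_0$, i.e. in terms of the values $u_1^{(k)}(t_0)$, $k=0,1,\dots$, and $\mu_1,\dots,\mu_{g-1}$.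
   Context: Prime denotes $\partial_x$. The differential polynomials $r_k[u]$ are defined by $r_0[u]=u'$ and $r_{k+1}[u]=\frac14 r_k[u]''-\frac12u'\,\partial_x^{-1}r_k[u]-u\,r_k[u]$, where $\partial_x^{-1}r_k[u]$ is the differential polynomial in $u$ without constant term whose $x$-derivative is $r_k[u]$. Stationary $g$-KdV equations are normalized so that the coefficient of $r_{g-1}$ is zero; the constants $a_0,\dots,a_{g-2}$ of the equation are part of the data. Determination of $u_2,\dots,u_g$: for $k=1,\dots,g-1$ the coefficient of $\xi^k$ in $\mathbf u'(\xi)^2+2\mathbf u''(\xi)(2-\mathbf u(\xi))+4(\xi^{-1}+u_1)(2-\mathbf u(\xi))^2$ equals $-16u_{k+1}$ plus a polynomial in $u_1,\dots,u_k$ and their first and second $x$-derivatives; equating it to $4\mu_k$ determines $u_{k+1}$ recursively as a polynomial $\Theta_{k+1}(u_1,u_1',\dots,u_1^{(2k)},\mu_1,\dots,\mu_k)$. *)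

theory Defs
  imports "HOL-Complex_Analysis.Complex_Analysis" "HOL-Library.Poly_Mapping"
begin

section \<open>Differential polynomials\<close>

text \<open>
  Differential polynomials in one function \<open>u\<close> are polynomials in the indeterminates
  \<open>Jet n\<close> (standing for the \<open>n\<close>-th \<open>x\<close>-derivative of \<open>u\<close>) and \<open>Par k\<close> (standing for the
  constant \<open>\<mu>\<^sub>k\<close>), represented as finitely supported families of complex coefficients indexed
  by monomials. A differential polynomial in \<open>u\<close> alone is one in which no \<open>Par k\<close> occurs.
\<close>

datatype indet = Jet nat | Par nat

type_synonym dpoly = "(indet \<Rightarrow>\<^sub>0 nat) \<Rightarrow>\<^sub>0 complex"

definition dconst :: "complex \<Rightarrow> dpoly" where
  "dconst c = Poly_Mapping.single 0 c"

definition indet :: "indet \<Rightarrow> dpoly" where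
  "indet v = Poly_Mapping.single (Poly_Mapping.single v 1) 1"

definition indets :: "dpoly \<Rightarrow> indet set" where
  "indets p = (\<Union>m\<in>Poly_Mapping.keys p. Poly_Mapping.keys m)"

definition peval :: "(indet \<Rightarrow> complex) \<Rightarrow> dpoly \<Rightarrow> complex" where
  "peval \<phi> p = (\<Sum>m\<in>Poly_Mapping.keys p. Poly_Mapping.lookup p m *
     (\<Prod>v\<in>Poly_Mapping.keys m. \<phi> v ^ Poly_Mapping.lookup m v))"

fun D_indet :: "indet \<Rightarrow> dpoly" where
  "D_indet (Jet n) = indet (Jet (Suc n))"
| "D_indet (Par k) = 0"

text \<open>The derivation \<open>\<partial>\<^sub>x\<close>: the sum over all indeterminates \<open>v\<close> of the partial derivative
  with respect to \<open>v\<close> times \<open>D_indet v\<close>.\<close>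

definition D :: "dpoly \<Rightarrow> dpoly" where
  "D p = (\<Sum>m\<in>Poly_Mapping.keys p. \<Sum>v\<in>Poly_Mapping.keys m.
     Poly_Mapping.single (m - Poly_Mapping.single v 1)
       (Poly_Mapping.lookup p m * of_nat (Poly_Mapping.lookup m v)) * D_indet v)"

definition D_inv :: "dpoly \<Rightarrow> dpoly" where
  "D_inv p = (THE q. D q = p \<and> indets q \<subseteq> range Jet \<and> Poly_Mapping.lookup q 0 = 0)"

primrec r_kdv :: "nat \<Rightarrow> dpoly" where
  "r_kdv 0 = indet (Jet 1)"
| "r_kdv (Suc k) = dconst (1/4) * D (D (r_kdv k))
     - dconst (1/2) * indet (Jet 1) * D_inv (r_kdv k) - indet (Jet 0) * r_kdv k"

section \<open>The generating series and the differential polynomials \<open>\<Theta>\<^sub>k\<close>\<close>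

text \<open>For \<open>\<u> = (\<Sum>i. w i \<xi>\<^sup>i)\<close> this is the formal series
  \<open>\<u>'\<^sup>2 + 2 \<u>'' (2 - \<u>) + 4 (\<xi>\<^sup>-\<^sup>1 + w 1) (2 - \<u>)\<^sup>2\<close> in the formal variable \<open>\<xi>\<close>
  (\<^const>\<open>fls_X_inv\<close> is \<open>\<xi>\<^sup>-\<^sup>1\<close>).\<close>

definition xi_series :: "(nat \<Rightarrow> dpoly) \<Rightarrow> dpoly fls" where
  "xi_series w = fps_to_fls (Abs_fps w)"

definition curve_series :: "(nat \<Rightarrow> dpoly) \<Rightarrow> dpoly fls" where
  "curve_series w =
     xi_series (\<lambda>i. D (w i)) ^ 2
     + 2 * xi_series (\<lambda>i. D (D (w i))) * (2 - xi_series w)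
     + 4 * (fls_X_inv + fls_const (w 1)) * (2 - xi_series w) ^ 2"

text \<open>For \<open>k \<ge> 1\<close> the coefficient of \<open>\<xi>\<^sup>k\<close> in the series above is \<open>-16 u\<^sub>k\<^sub>+\<^sub>1\<close> plus an
  expression in \<open>u\<^sub>1, \<dots>, u\<^sub>k\<close>; the latter is the coefficient of the series in which
  \<open>u\<^sub>k\<^sub>+\<^sub>1, u\<^sub>k\<^sub>+\<^sub>2, \<dots>\<close> are replaced by \<open>0\<close>. Equating the coefficient to \<open>4 \<mu>\<^sub>k\<close> and solving for
  \<open>u\<^sub>k\<^sub>+\<^sub>1\<close> gives the last equation (with \<open>Suc k\<close> in place of \<open>k\<close>).\<close>

fun Theta :: "nat \<Rightarrow> dpoly" where
  "Theta 0 = 0"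
| "Theta (Suc 0) = indet (Jet 0)"
| "Theta (Suc (Suc k)) = dconst (1/16) *
     (fls_nth (curve_series (\<lambda>i. if i \<le> Suc k then Theta i else 0)) (int (Suc k))
      - 4 * indet (Par (Suc k)))"

section \<open>Functions of \<open>x\<close>\<close>

text \<open>The independent variable ranges over a complex domain or over an open interval of the
  real line (regarded as a subset of the complex plane). In both cases the derivative is the
  one along the set, so that in the second case it is the ordinary derivative of a
  complex-valued function of a real variable.\<close>

definition x_domain :: "complex set \<Rightarrow> bool" where
  "x_domain S \<longleftrightarrow> S \<noteq> {} \<and> connected S \<and>
     (open S \<or> (\<exists>I :: real set. open I \<and> S = complex_of_real ` I))"

definition deriv_on :: "complex set \<Rightarrow> (complex \<Rightarrow> complex) \<Rightarrow> complex \<Rightarrow> complex" where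
  "deriv_on S f x = (THE d. (f has_field_derivative d) (at x within S))"

definition smooth_fun_on :: "complex set \<Rightarrow> (complex \<Rightarrow> complex) \<Rightarrow> bool" where
  "smooth_fun_on S f \<longleftrightarrow>
     (\<forall>n. \<forall>x\<in>S. (deriv_on S ^^ n) f field_differentiable (at x within S))"

definition jet_val ::
  "complex set \<Rightarrow> (complex \<Rightarrow> complex) \<Rightarrow> (nat \<Rightarrow> complex) \<Rightarrow> complex \<Rightarrow> indet \<Rightarrow> complex" where
  "jet_val S f \<mu> x v = (case v of Jet n \<Rightarrow> (deriv_on S ^^ n) f x | Par k \<Rightarrow> \<mu> k)"

text \<open>The stationary \<open>g\<close>-KdV equation
  \<open>r\<^sub>g[f] + (\<Sum>k=0..g-2. a\<^sub>k r\<^sub>k[f]) = 0\<close>; the sum is empty for \<open>g = 1\<close>. The \<open>r\<^sub>k\<close> contain no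
  \<open>Par\<close>, so the parameter values passed to \<^const>\<open>jet_val\<close> are irrelevant.\<close>

definition stationary_kdv ::
  "nat \<Rightarrow> (nat \<Rightarrow> complex) \<Rightarrow> complex set \<Rightarrow> (complex \<Rightarrow> complex) \<Rightarrow> bool" where
  "stationary_kdv g a S f \<longleftrightarrow> (\<forall>x\<in>S.
     peval (jet_val S f (\<lambda>_. 0) x) (r_kdv g)
     + (\<Sum>k<g-1. a k * peval (jet_val S f (\<lambda>_. 0) x) (r_kdv k)) = 0)"

text \<open>The function \<open>\<u>(\<xi>) = (\<Sum>i=1..g. u\<^sub>i \<xi>\<^sup>i)\<close>, evaluated at \<open>x\<close>, for \<open>u\<^sub>1 = f\<close> and
  parameter values \<open>\<mu>\<close>.\<close>

definition bold_u ::
  "nat \<Rightarrow> complex set \<Rightarrow> (complex \<Rightarrow> complex) \<Rightarrow> (nat \<Rightarrow> complex) \<Rightarrow> complex \<Rightarrow> complex \<Rightarrow> complex" where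
  "bold_u g S f \<mu> \<xi> x = (\<Sum>i=1..g. peval (jet_val S f \<mu> x) (Theta i) * \<xi> ^ i)"

definition mu_fun :: "nat \<Rightarrow> (nat \<Rightarrow> complex) \<Rightarrow> complex \<Rightarrow> complex" where
  "mu_fun g \<mu> \<xi> = 4 / \<xi> + (\<Sum>i=1..2*g. \<mu> i * \<xi> ^ i)"

text \<open>The point \<open>\<xi> = 0\<close> has to be excluded explicitly, because \<open>4 / 0 = 0\<close> in HOL.\<close>

definition spectral_curve :: "nat \<Rightarrow> (nat \<Rightarrow> complex) \<Rightarrow> (complex \<times> complex) set" where
  "spectral_curve g \<mu> = {(\<xi>, y). \<xi> \<noteq> 0 \<and> y\<^sup>2 = 4 * mu_fun g \<mu> \<xi>}"

text \<open>The sequence \<open>\<mu>\<close> consists of \<open>\<mu>\<^sub>1, \<dots>, \<mu>\<^sub>2\<^sub>g\<close> (extended by \<open>0\<close>), its first \<open>g - 1\<close> entries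
  are given by the coefficients of the equation, and the curve identity holds for all \<open>x\<close>.\<close>

definition curve_data ::
  "nat \<Rightarrow> (nat \<Rightarrow> complex) \<Rightarrow> complex set \<Rightarrow> (complex \<Rightarrow> complex) \<Rightarrow> (nat \<Rightarrow> complex) \<Rightarrow> bool" where
  "curve_data g a S f \<mu> \<longleftrightarrow>
     (\<forall>k. k \<notin> {1..2*g} \<longrightarrow> \<mu> k = 0) \<and>
     (\<forall>k\<in>{1..<g}. \<mu> k = 8 * a (g-k-1) + 4 * (\<Sum>i=1..k-2. a (g-i-1) * a (g-k+i))) \<and>
     (\<forall>x\<in>S. \<forall>\<xi>. \<xi> \<noteq> 0 \<longrightarrow>
        4 * mu_fun g \<mu> \<xi> =
          (deriv_on S (bold_u g S f \<mu> \<xi>) x)\<^sup>2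
          + 2 * deriv_on S (deriv_on S (bold_u g S f \<mu> \<xi>)) x * (2 - bold_u g S f \<mu> \<xi> x)
          + 4 * (1 / \<xi> + f x) * (2 - bold_u g S f \<mu> \<xi> x)\<^sup>2)"

end

theory Submission
  imports Defs
begin

text \<open>
  Multiplied by \<open>\<xi>\<close>, the right-hand side of the curve identity is a series
  \<open>E(\<u>) = \<xi>\<u>'\<^sup>2 + 2\<xi>\<u>''(2 - \<u>) + 4(1 + u\<^sub>1\<xi>)(2 - \<u>)\<^sup>2\<close> whose \<open>x\<close>-derivative is
  \<open>2(2 - \<u>)\<close> times \<open>\<xi>\<u>''' + 2\<xi>u\<^sub>1'(2 - \<u>) - 4(1 + u\<^sub>1\<xi>)\<u>'\<close>. So if the coefficients of \<open>E(\<u>)\<close>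
  are constant, then the second factor vanishes, which is the recursion defining the \<open>r\<^sub>k\<close>; the
  solution \<open>w\<close> with \<open>E(w) = 16\<close> satisfies \<open>w\<^sub>k\<^sub>+\<^sub>1' = r\<^sub>k\<close>. The solution with the given \<open>\<mu>\<^sub>k\<close> is
  \<open>2 - \<u> = b(2 - w)\<close>, where \<open>b\<^sup>2 = 1 + (\<Sum>k\<ge>1. \<mu>\<^sub>k\<xi>\<^sup>k\<^sup>+\<^sup>1/4)\<close>, and the formula for \<open>\<mu>\<^sub>k\<close> says that
  \<open>b\<^sub>i = a\<^sub>g\<^sub>-\<^sub>i\<close> for \<open>2 \<le> i \<le> g\<close>. The stationary equation is therefore \<open>u\<^sub>g\<^sub>+\<^sub>1' = 0\<close>. Truncating \<open>\<u>\<close>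
  after \<open>\<xi>\<^sup>g\<close> changes the second factor only by \<open>4u\<^sub>g\<^sub>+\<^sub>1'\<xi>\<^sup>g\<^sup>+\<^sup>1\<close>, so \<open>E\<close> of the truncation still has
  constant coefficients.
\<close>

unbundle no vec_syntax

section \<open>The differential ring of differential polynomials\<close>

abbreviation dmonom :: "(indet \<Rightarrow>\<^sub>0 nat) \<Rightarrow> complex \<Rightarrow> dpoly" where
  "dmonom \<equiv> Poly_Mapping.single"

section \<open>Induction over monomials and over ring generators\<close>

lemma dpoly_sum_monos: "p = (\<Sum>m\<in>Poly_Mapping.keys p. dmonom m (Poly_Mapping.lookup p m))"
  by (rule poly_mapping_eqI) (auto simp: lookup_sum lookup_single when_def in_keys_iff)

lemma dpoly_mono_induct [case_names mono add]:
  assumes "\<And>m c. P (dmonom m c)" and "\<And>p q. P p \<Longrightarrow> P q \<Longrightarrow> P (p + q)"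
  shows "P (p :: dpoly)"
proof -
  have "P (\<Sum>m\<in>A. dmonom m (Poly_Mapping.lookup p m))" if "finite A" for A
    using that
  proof (induction A)
    case empty
    show ?case using assms(1)[of 0 0] by simp
  qed (auto intro: assms)
  then show ?thesis
    using dpoly_sum_monos[of p] by (metis finite_keys)
qed

lemma dconst_simps [simp]:
  "dconst 0 = 0" "dconst 1 = 1" "dconst (numeral n) = numeral n"
  by (simp_all add: dconst_def)

lemma dconst_hom:
  "dconst (c + d) = dconst c + dconst d" "dconst (c * d) = dconst c * dconst d"
  "dconst (c - d) = dconst c - dconst d"
  by (simp_all add: dconst_def single_add mult_single single_diff)

text \<open>Constants and indeterminates generate the ring. Statements about \<open>D\<close> and
  \<open>peval\<close> reduce to them once the behaviour on products is known.\<close>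

lemma dpoly_induct [case_names const indet add mult]:
  assumes const: "\<And>c. P (dconst c)" and indet: "\<And>v. P (indet v)"
    and add: "\<And>p q. P p \<Longrightarrow> P q \<Longrightarrow> P (p + q)"
    and mult: "\<And>p q. P p \<Longrightarrow> P q \<Longrightarrow> P (p * q)"
  shows "P (p :: dpoly)"
proof (induction p rule: dpoly_mono_induct)
  case (mono m c)
  have pow: "P (dmonom (Poly_Mapping.single v n) 1)" for v n
  proof (induction n)
    case 0
    show ?case using const[of 1] by simp
  next
    case (Suc n)
    have "dmonom (Poly_Mapping.single v (Suc n)) 1 = dmonom (Poly_Mapping.single v n) 1 * indet v"
      by (simp add: indet_def mult_single flip: single_add)
    then show ?case using mult Suc indet by metis
  qed
  have "P (dmonom m 1)"
  proof (induction m rule: update_induct)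
    case const
    show ?case using assms(1)[of 1] by simp
  next
    case (update f v n)
    have "Poly_Mapping.update v n f = Poly_Mapping.single v n + f"
      using update.hyps by (intro poly_mapping_eqI)
        (auto simp: lookup_update lookup_add lookup_single when_def in_keys_iff)
    then have "dmonom (Poly_Mapping.update v n f) 1 = dmonom (Poly_Mapping.single v n) 1 * dmonom f 1"
      by (simp add: mult_single)
    then show ?case using mult pow update.IH by metis
  qed
  then have "P (dconst c * dmonom m 1)" using mult const by blast
  then show ?case by (simp add: dconst_def mult_single)
qed (rule add)

section \<open>Evaluation as a ring homomorphism\<close>

definition mono_val :: "(indet \<Rightarrow> complex) \<Rightarrow> (indet \<Rightarrow>\<^sub>0 nat) \<Rightarrow> complex" where
  "mono_val \<phi> m = (\<Prod>v\<in>Poly_Mapping.keys m. \<phi> v ^ Poly_Mapping.lookup m v)"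

lemma mono_val_superset:
  "finite A \<Longrightarrow> Poly_Mapping.keys m \<subseteq> A \<Longrightarrow>
    mono_val \<phi> m = (\<Prod>v\<in>A. \<phi> v ^ Poly_Mapping.lookup m v)"
  unfolding mono_val_def by (rule prod.mono_neutral_left) (auto simp: in_keys_iff)

lemma mono_val_plus: "mono_val \<phi> (m + m') = mono_val \<phi> m * mono_val \<phi> m'"
proof -
  let ?A = "Poly_Mapping.keys m \<union> Poly_Mapping.keys m'"
  have "mono_val \<phi> (m + m') = (\<Prod>v\<in>?A. \<phi> v ^ Poly_Mapping.lookup (m + m') v)"
    by (rule mono_val_superset) (use keys_add[of m m'] in auto)
  also have "\<dots> = (\<Prod>v\<in>?A. \<phi> v ^ Poly_Mapping.lookup m v) * (\<Prod>v\<in>?A. \<phi> v ^ Poly_Mapping.lookup m' v)"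
    by (simp add: lookup_add power_add prod.distrib)
  also have "\<dots> = mono_val \<phi> m * mono_val \<phi> m'"
    by (simp add: mono_val_superset[of ?A])
  finally show ?thesis .
qed

lemma peval_superset:
  "finite A \<Longrightarrow> Poly_Mapping.keys p \<subseteq> A \<Longrightarrow>
    peval \<phi> p = (\<Sum>m\<in>A. Poly_Mapping.lookup p m * mono_val \<phi> m)"
  unfolding peval_def mono_val_def by (rule sum.mono_neutral_left) (auto simp: in_keys_iff)

lemma peval_mono: "peval \<phi> (dmonom m c) = c * mono_val \<phi> m"
  by (simp add: peval_superset[of "{m}"])

lemma peval_add [simp]: "peval \<phi> (p + q) = peval \<phi> p + peval \<phi> q"
proof -
  let ?A = "Poly_Mapping.keys p \<union> Poly_Mapping.keys q"
  show ?thesis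
    using keys_add[of p q]
    by (simp add: peval_superset[of ?A] lookup_add distrib_right sum.distrib)
qed

lemma peval_mult [simp]: "peval \<phi> (p * q) = peval \<phi> p * peval \<phi> q"
proof (induction p rule: dpoly_mono_induct)
  case (mono m c)
  show ?case
    by (induction q rule: dpoly_mono_induct)
      (simp_all add: mult_single peval_mono mono_val_plus distrib_left)
qed (simp add: distrib_right)

lemma peval_dconst [simp]: "peval \<phi> (dconst c) = c"
  by (simp add: dconst_def peval_mono mono_val_def)

lemma peval_indet [simp]: "peval \<phi> (indet v) = \<phi> v"
  by (simp add: indet_def peval_mono mono_val_def)

lemma peval_simps [simp]:
  "peval \<phi> 0 = 0" "peval \<phi> 1 = 1" "peval \<phi> (numeral n) = numeral n"
  using peval_dconst[of \<phi> 0] peval_dconst[of \<phi> 1] peval_dconst[of \<phi> "numeral n"]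
  by (simp_all del: peval_dconst)

lemma peval_diff [simp]: "peval \<phi> (p - q) = peval \<phi> p - peval \<phi> q"
  using peval_add[of \<phi> "p - q" q] by (simp del: peval_add)

lemma peval_sum [simp]: "peval \<phi> (\<Sum>i\<in>A. f i) = (\<Sum>i\<in>A. peval \<phi> (f i))"
  by (induction A rule: infinite_finite_induct) auto

lemma peval_cong:
  assumes "\<And>v. v \<in> indets p \<Longrightarrow> \<phi> v = \<psi> v"
  shows "peval \<phi> p = peval \<psi> p"
proof -
  have "\<phi> v = \<psi> v" if "m \<in> Poly_Mapping.keys p" "v \<in> Poly_Mapping.keys m" for m v
    using assms[of v] that by (auto simp: indets_def)
  then show ?thesis by (simp add: peval_def)
qed

text \<open>Setting all indeterminates to 0 leaves the constant term. This turns the normalization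
  in \<open>D_inv\<close> into a condition on a ring homomorphism, which can be applied to whole
  identities.\<close>

lemma lookup_0_eq_peval: "Poly_Mapping.lookup p 0 = peval (\<lambda>_. 0) p"
proof (induction p rule: dpoly_mono_induct)
  case (mono m c)
  have "mono_val (\<lambda>_. 0) m = 0" if "m \<noteq> 0"
  proof -
    have "Poly_Mapping.keys m \<noteq> {}" using that by simp
    then obtain v where v: "v \<in> Poly_Mapping.keys m" by blast
    then have "(0 :: complex) ^ Poly_Mapping.lookup m v = 0"
      by (simp only: in_keys_iff power_0_left if_False)
    then show ?thesis
      unfolding mono_val_def using v by (intro prod_zero) (rule finite_keys, rule bexI)
  qed
  moreover have "mono_val (\<lambda>_. 0) 0 = 1" by (simp add: mono_val_def)
  ultimately show ?case
    by (cases "m = 0") (auto simp: peval_mono lookup_single when_def)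
qed (simp add: lookup_add)

lemma indets_add: "indets (p + q) \<subseteq> indets p \<union> indets q"
  unfolding indets_def using keys_add[of p q] by auto

lemma indets_mult: "indets (p * q) \<subseteq> indets p \<union> indets q"
proof
  fix v assume "v \<in> indets (p * q)"
  then obtain m where m: "m \<in> Poly_Mapping.keys (p * q)" "v \<in> Poly_Mapping.keys m"
    by (auto simp: indets_def)
  then obtain a b where ab: "m = a + b" "a \<in> Poly_Mapping.keys p" "b \<in> Poly_Mapping.keys q"
    using keys_mult[of p q] by blast
  then show "v \<in> indets p \<union> indets q"
    using m keys_add[of a b] by (auto simp: indets_def)
qed

lemma indets_uminus [simp]: "indets (- p) = indets p"
  by (simp add: indets_def keys_def)

lemma indets_diff: "indets (p - q) \<subseteq> indets p \<union> indets q"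
  using indets_add[of p "- q"] by simp

lemma indets_dconst [simp]: "indets (dconst c) = {}"
  by (auto simp: indets_def dconst_def split: if_splits)

lemma indets_0 [simp]: "indets 0 = {}" and indets_numeral [simp]: "indets (numeral n) = {}"
  using indets_dconst[of 0] indets_dconst[of "numeral n"] by (simp_all del: indets_dconst)

lemma indets_indet [simp]: "indets (indet v) = {v}"
  by (simp add: indets_def indet_def)

lemma indets_sum: "indets (\<Sum>i\<in>A. f i) \<subseteq> (\<Union>i\<in>A. indets (f i))"
  by (induction A rule: infinite_finite_induct) (use indets_add in fastforce)+

section \<open>The derivation and its kernel\<close>

definition D_mono :: "(indet \<Rightarrow>\<^sub>0 nat) \<Rightarrow> dpoly" where
  "D_mono m = (\<Sum>v\<in>Poly_Mapping.keys m.
     dmonom (m - Poly_Mapping.single v 1) (of_nat (Poly_Mapping.lookup m v)) * D_indet v)"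

lemma D_mono_superset:
  "finite A \<Longrightarrow> Poly_Mapping.keys m \<subseteq> A \<Longrightarrow> D_mono m =
    (\<Sum>v\<in>A. dmonom (m - Poly_Mapping.single v 1) (of_nat (Poly_Mapping.lookup m v)) * D_indet v)"
  unfolding D_mono_def by (rule sum.mono_neutral_left) (auto simp: in_keys_iff)

lemma D_mono_plus: "D_mono (m + m') = D_mono m * dmonom m' 1 + dmonom m 1 * D_mono m'"
proof -
  let ?A = "Poly_Mapping.keys m \<union> Poly_Mapping.keys m'"
  \<comment> \<open>Exponents are subtracted with truncation, so the identity of exponents can fail
    where \<open>v\<close> does not occur in \<open>m\<close>; there the coefficient is 0.\<close>
  have shift: "dmonom (m + m' - Poly_Mapping.single v 1) (of_nat (Poly_Mapping.lookup m v))
     = dmonom (m - Poly_Mapping.single v 1) (of_nat (Poly_Mapping.lookup m v)) * dmonom m' 1" for m m' v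
  proof (cases "Poly_Mapping.lookup m v = 0")
    case False
    then have "m + m' - Poly_Mapping.single v 1 = (m - Poly_Mapping.single v 1) + m'"
      by (intro poly_mapping_eqI) (auto simp: lookup_add lookup_minus lookup_single when_def)
    then show ?thesis by (simp add: mult_single)
  qed simp
  have "D_mono (m + m') = (\<Sum>v\<in>?A. dmonom (m + m' - Poly_Mapping.single v 1)
     (of_nat (Poly_Mapping.lookup (m + m') v)) * D_indet v)"
    by (rule D_mono_superset) (use keys_add[of m m'] in auto)
  also have "\<dots> = (\<Sum>v\<in>?A. dmonom (m - Poly_Mapping.single v 1) (of_nat (Poly_Mapping.lookup m v))
      * D_indet v * dmonom m' 1 + dmonom m 1 *
      (dmonom (m' - Poly_Mapping.single v 1) (of_nat (Poly_Mapping.lookup m' v)) * D_indet v))"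
    by (intro sum.cong refl) (simp only: lookup_add of_nat_add single_add distrib_right
        distrib_left shift[of m m'] shift[of m' m, unfolded add.commute[of m' m]] ac_simps)
  also have "\<dots> = D_mono m * dmonom m' 1 + dmonom m 1 * D_mono m'"
    by (simp add: D_mono_superset[of ?A] sum.distrib sum_distrib_left sum_distrib_right)
  finally show ?thesis .
qed

lemma D_superset:
  assumes "finite A" "Poly_Mapping.keys p \<subseteq> A"
  shows "D p = (\<Sum>m\<in>A. dconst (Poly_Mapping.lookup p m) * D_mono m)"
proof -
  have "D p = (\<Sum>m\<in>Poly_Mapping.keys p. dconst (Poly_Mapping.lookup p m) * D_mono m)"
    by (simp add: D_def D_mono_def dconst_def sum_distrib_left mult_single flip: mult.assoc)
  also have "\<dots> = (\<Sum>m\<in>A. dconst (Poly_Mapping.lookup p m) * D_mono m)"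
    using assms by (intro sum.mono_neutral_left) (auto simp: in_keys_iff)
  finally show ?thesis .
qed

lemma D_single: "D (dmonom m c) = dconst c * D_mono m"
  by (simp add: D_superset[of "{m}"])

lemma D_add [simp]: "D (p + q) = D p + D q"
proof -
  let ?A = "Poly_Mapping.keys p \<union> Poly_Mapping.keys q"
  show ?thesis
    using keys_add[of p q]
    by (simp add: D_superset[of ?A] lookup_add dconst_hom distrib_right sum.distrib)
qed

lemma D_mult: "D (p * q) = D p * q + p * D q"
proof (induction p rule: dpoly_mono_induct)
  case (mono m c)
  have s: "dmonom k d = dconst d * dmonom k 1" for k d
    by (simp add: dconst_def mult_single)
  show ?case
  proof (induction q rule: dpoly_mono_induct)
    case (mono m' c')
    have "D (dmonom m c * dmonom m' c')
        = dconst c * dconst c' * (D_mono m * dmonom m' 1 + dmonom m 1 * D_mono m')"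
      by (simp only: mult_single D_single D_mono_plus dconst_hom)
    also have "\<dots> = D (dmonom m c) * dmonom m' c' + dmonom m c * D (dmonom m' c')"
      unfolding D_single unfolding s[of m c] s[of m' c'] by (simp only: distrib_left distrib_right ac_simps)
    finally show ?case .
  qed (simp add: distrib_left algebra_simps)
qed (simp add: algebra_simps)

lemma D_dconst [simp]: "D (dconst c) = 0"
  by (simp add: dconst_def D_single D_mono_def)

lemma D_indet_eq [simp]: "D (indet v) = D_indet v"
  by (simp add: indet_def D_single D_mono_def)

lemma D_simps [simp]: "D 0 = 0" "D 1 = 0" "D (numeral n) = 0"
  using D_dconst[of 0] D_dconst[of 1] D_dconst[of "numeral n"] by (simp_all del: D_dconst)

lemma D_diff [simp]: "D (p - q) = D p - D q"
  using D_add[of "p - q" q] by (simp del: D_add add: algebra_simps)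

lemma D_sum [simp]: "D (\<Sum>i\<in>A. f i) = (\<Sum>i\<in>A. D (f i))"
  by (induction A rule: infinite_finite_induct) auto

lemma peval_0_D [simp]: "peval (\<lambda>_. 0) (D p) = 0"
proof (induction p rule: dpoly_induct)
  case (indet v)
  show ?case by (cases v) auto
qed (auto simp: D_mult)

lemma indets_D: "indets (D p) \<subseteq> indets p \<union> range Jet"
proof -
  have "indets (dmonom (m - Poly_Mapping.single v 1) c * D_indet v) \<subseteq> indets p \<union> range Jet"
    if m: "m \<in> Poly_Mapping.keys p" for m v c
  proof -
    have "indets (dmonom (m - Poly_Mapping.single v 1) c) \<subseteq> Poly_Mapping.keys m"
      by (auto simp: indets_def in_keys_iff lookup_minus split: if_splits)
    also have "\<dots> \<subseteq> indets p" using m by (auto simp: indets_def)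
    finally have "indets (dmonom (m - Poly_Mapping.single v 1) c) \<subseteq> indets p" .
    moreover have "indets (D_indet v) \<subseteq> range Jet" by (cases v) auto
    ultimately show ?thesis using indets_mult by blast
  qed
  then show ?thesis
    unfolding D_def by (intro order.trans[OF indets_sum] UN_least)
qed

text \<open>If \<open>Jet n\<close> is the highest jet of \<open>p\<close> and occurs in the monomial \<open>m\<^sub>0\<close>, then the monomial
  \<open>m\<^sub>0 Jet (n+1) / Jet n\<close> of \<open>D p\<close> has no other source than \<open>m\<^sub>0\<close>.\<close>

lemma D_eq_0_imp_const:
  assumes D0: "D p = 0" and jets: "indets p \<subseteq> range Jet"
  shows "p = dconst (Poly_Mapping.lookup p 0)"
proof -
  have "indets p = {}"
  proof (rule ccontr)
    assume ne: "indets p \<noteq> {}"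
    have "finite (indets p)" by (auto simp: indets_def)
    then have fin: "finite {n. Jet n \<in> indets p}"
      using finite_vimageI[of "indets p" Jet] by (auto simp: vimage_def inj_def)
    define n where "n = Max {n. Jet n \<in> indets p}"
    have n: "Jet n \<in> indets p"
      using Max_in[OF fin] ne jets unfolding n_def by auto
    have n_max: "j \<le> n" if "Jet j \<in> indets p" for j
      unfolding n_def using fin that by simp
    obtain m0 where m0: "m0 \<in> Poly_Mapping.keys p" "Jet n \<in> Poly_Mapping.keys m0"
      using n by (auto simp: indets_def)
    define k where "k = m0 - Poly_Mapping.single (Jet n) 1 + Poly_Mapping.single (Jet (Suc n)) 1"
    have no_Suc: "Poly_Mapping.lookup m (Jet (Suc n)) = 0" if "m \<in> Poly_Mapping.keys p" for m
      using n_max[of "Suc n"] that by (fastforce simp: indets_def in_keys_iff)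
    have k_Suc: "Poly_Mapping.lookup k (Jet (Suc n)) = 1"
      using no_Suc[OF m0(1)] by (simp add: k_def lookup_add lookup_minus lookup_single)
    have coeff: "Poly_Mapping.lookup (dmonom (m - Poly_Mapping.single v 1) c * D_indet v) k
       = (if m = m0 \<and> v = Jet n then c else 0)"
      if m: "m \<in> Poly_Mapping.keys p" and v: "v \<in> Poly_Mapping.keys m" for m v c
    proof -
      obtain j where j: "v = Jet j" using m v jets by (auto simp: indets_def)
      have "dmonom (m - Poly_Mapping.single v 1) c * D_indet v =
          dmonom (m - Poly_Mapping.single (Jet j) 1 + Poly_Mapping.single (Jet (Suc j)) 1) c"
        by (simp add: j indet_def mult_single)
      moreover have "m = m0 \<and> j = n"
        if eq: "m - Poly_Mapping.single (Jet j) 1 + Poly_Mapping.single (Jet (Suc j)) 1 = k"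
      proof -
        have "Poly_Mapping.lookup (m - Poly_Mapping.single (Jet j) 1
            + Poly_Mapping.single (Jet (Suc j)) 1) (Jet (Suc n)) = 1"
          using eq k_Suc by simp
        \<comment> \<open>No monomial of \<open>p\<close> contains \<open>Jet (Suc n)\<close>, so
          this factor can only come from differentiating \<open>Jet n\<close>.\<close>
        then have jn: "j = n"
          using no_Suc[OF m] by (cases "j = n") (simp_all add: lookup_add lookup_minus lookup_single)
        have eq': "m - Poly_Mapping.single (Jet n) 1 = m0 - Poly_Mapping.single (Jet n) 1"
          using eq jn unfolding k_def by simp
        have "Poly_Mapping.lookup m w = Poly_Mapping.lookup m0 w" for w
        proof (cases "w = Jet n")
          case True
          have "Poly_Mapping.lookup m w \<noteq> 0" "Poly_Mapping.lookup m0 w \<noteq> 0"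
            using v j jn m0 True by (auto simp: in_keys_iff)
          then show ?thesis
            using arg_cong[OF eq', of "\<lambda>f. Poly_Mapping.lookup f w"] True
            by (simp add: lookup_minus)
        next
          case False
          then show ?thesis
            using arg_cong[OF eq', of "\<lambda>f. Poly_Mapping.lookup f w"]
            by (simp add: lookup_minus lookup_single)
        qed
        then show ?thesis using jn by (auto intro: poly_mapping_eqI)
      qed
      ultimately show ?thesis
        using m0 by (auto simp: lookup_single when_def j k_def)
    qed
    have "0 = Poly_Mapping.lookup (D p) k" using D0 by simp
    also have "\<dots> = (\<Sum>m\<in>Poly_Mapping.keys p. \<Sum>v\<in>Poly_Mapping.keys m. if m = m0 \<and> v = Jet n
        then Poly_Mapping.lookup p m * of_nat (Poly_Mapping.lookup m v) else 0)"
      unfolding D_def lookup_sum by (intro sum.cong refl) (simp only: coeff)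
    also have "\<dots> = (\<Sum>m\<in>Poly_Mapping.keys p. if m = m0
        then Poly_Mapping.lookup p m0 * of_nat (Poly_Mapping.lookup m0 (Jet n)) else 0)"
    proof (intro sum.cong refl)
      fix m
      show "(\<Sum>v\<in>Poly_Mapping.keys m. if m = m0 \<and> v = Jet n
          then Poly_Mapping.lookup p m * of_nat (Poly_Mapping.lookup m v) else 0)
        = (if m = m0 then Poly_Mapping.lookup p m0 * of_nat (Poly_Mapping.lookup m0 (Jet n)) else 0)"
        by (cases "m = m0") (simp_all add: m0(2))
    qed
    also have "\<dots> = Poly_Mapping.lookup p m0 * of_nat (Poly_Mapping.lookup m0 (Jet n))"
      using m0 by simp
    \<comment> \<open>A nonzero coefficient times a positive exponent is nonzero in characteristic
      0.\<close>
    finally show False using m0 by (auto simp: in_keys_iff)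
  qed
  then have "Poly_Mapping.keys m = {}" if "m \<in> Poly_Mapping.keys p" for m
    using that by (auto simp: indets_def)
  then have "Poly_Mapping.lookup p m = 0" if "m \<noteq> 0" for m
    using that by (metis in_keys_iff keys_eq_empty)
  then show ?thesis
    by (intro poly_mapping_eqI) (auto simp: dconst_def lookup_single when_def)
qed

text \<open>Two candidates differ by a parameter-free element of the kernel of \<open>D\<close>,
  hence by a constant, and the normalization makes it 0.\<close>

lemma D_inv_eq:
  assumes "D q = p" "indets q \<subseteq> range Jet" "Poly_Mapping.lookup q 0 = 0"
  shows "D_inv p = q"
  unfolding D_inv_def
proof (rule the_equality)
  fix q' assume q': "D q' = p \<and> indets q' \<subseteq> range Jet \<and> Poly_Mapping.lookup q' 0 = 0"
  have "q' - q = dconst (Poly_Mapping.lookup (q' - q) 0)"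
    by (rule D_eq_0_imp_const) (use assms q' indets_diff[of q' q] in auto)
  then show "q' = q" using assms q' by (simp add: lookup_minus)
qed (use assms in simp)

section \<open>Power series of differential polynomials\<close>

text \<open>Coefficients of \<open>G\<close> are cleared degree by degree, \<open>v\<close> being
  the inverse of the constant coefficient of \<open>F\<close>. The bound \<open>n\<close> serves
  products known to vanish only up to some degree.\<close>

lemma fps_unit_cancel:
  fixes F G :: "'a::comm_ring_1 fps"
  assumes unit: "F $ 0 * v = 1" and zero: "\<And>k. k \<le> n \<Longrightarrow> (F * G) $ k = 0"
  shows "k \<le> n \<Longrightarrow> G $ k = 0"
proof (induction k rule: less_induct)
  case (less k)
  have "(F * G) $ k = (\<Sum>i=0..k. F $ i * G $ (k - i))" by (rule fps_mult_nth)
  also have "\<dots> = (\<Sum>i\<in>{0}. F $ i * G $ (k - i))"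
    using less by (intro sum.mono_neutral_right) auto
  finally have "F $ 0 * G $ k = 0" using zero less.prems by simp
  then have "(F $ 0 * v) * G $ k = 0" by (metis mult.assoc mult.commute mult_zero_left)
  then show ?case using unit by simp
qed

lemma fps_unit_cancel_all:
  fixes F G :: "'a::comm_ring_1 fps"
  assumes "F $ 0 * v = 1" "F * G = 0"
  shows "G = 0"
proof (rule fps_ext)
  show "G $ n = 0 $ n" for n
    using fps_unit_cancel[OF assms(1), of n G n] assms(2) by simp
qed

text \<open>Here \<open>h\<close> stands for 1/2: in degree \<open>Suc n\<close> of the square, the
  unknown coefficient occurs twice, each time multiplied by the constant coefficient 1.\<close>

fun sqrt_coeff :: "'a::comm_ring_1 \<Rightarrow> 'a fps \<Rightarrow> nat \<Rightarrow> 'a" where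
  "sqrt_coeff h S 0 = 1"
| "sqrt_coeff h S (Suc n) = h * (S $ Suc n - (\<Sum>i=1..n. sqrt_coeff h S i * sqrt_coeff h S (Suc n - i)))"

lemma fps_sqrt_exists:
  fixes S :: "'a::comm_ring_1 fps"
  assumes h: "2 * h = (1 :: 'a)" and S: "S $ 0 = 1"
  obtains B where "B ^ 2 = S" "B $ 0 = 1"
proof
  let ?B = "Abs_fps (sqrt_coeff h S)"
  show "?B ^ 2 = S"
  proof (rule fps_ext)
    fix n
    show "(?B ^ 2) $ n = S $ n"
    proof (cases n)
      case (Suc m)
      have "{0..Suc m} = insert 0 (insert (Suc m) {1..m})" by auto
      then have "(?B ^ 2) $ n = 2 * sqrt_coeff h S (Suc m)
          + (\<Sum>i=1..m. sqrt_coeff h S i * sqrt_coeff h S (Suc m - i))"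
        by (simp add: Suc power2_eq_square fps_mult_nth algebra_simps del: sqrt_coeff.simps(2))
      also have "\<dots> = (2 * h) * (S $ Suc m
          - (\<Sum>i=1..m. sqrt_coeff h S i * sqrt_coeff h S (Suc m - i)))
          + (\<Sum>i=1..m. sqrt_coeff h S i * sqrt_coeff h S (Suc m - i))"
        by (simp add: mult.assoc)
      finally show ?thesis by (simp add: h Suc)
    qed (simp add: S power2_eq_square fps_mult_nth)
  qed
qed simp

section \<open>Coefficientwise derivation and evaluation of power series\<close>

definition D_fps :: "dpoly fps \<Rightarrow> dpoly fps" where
  "D_fps F = Abs_fps (\<lambda>n. D (F $ n))"

lemma D_fps_nth [simp]: "D_fps F $ n = D (F $ n)"
  by (simp add: D_fps_def)

lemma D_fps_simps [simp]:
  "D_fps (F + G) = D_fps F + D_fps G" "D_fps (F - G) = D_fps F - D_fps G"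
  "D_fps (numeral k) = 0" "D_fps 1 = 0" "D_fps fps_X = 0" "D_fps (fps_const p) = fps_const (D p)"
  by (auto simp: fps_eq_iff fps_numeral_nth fps_X_def)

lemma D_fps_mult: "D_fps (F * G) = D_fps F * G + F * D_fps G"
  by (simp add: fps_eq_iff fps_mult_nth D_mult sum.distrib)

lemma D_fps_power2: "D_fps (F ^ 2) = 2 * F * D_fps F"
  by (simp add: power2_eq_square D_fps_mult algebra_simps)

definition peval_fps :: "(indet \<Rightarrow> complex) \<Rightarrow> dpoly fps \<Rightarrow> complex fps" where
  "peval_fps \<phi> F = Abs_fps (\<lambda>n. peval \<phi> (F $ n))"

lemma peval_fps_nth [simp]: "peval_fps \<phi> F $ n = peval \<phi> (F $ n)"
  by (simp add: peval_fps_def)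

lemma peval_fps_simps [simp]:
  "peval_fps \<phi> (F + G) = peval_fps \<phi> F + peval_fps \<phi> G"
  "peval_fps \<phi> (F - G) = peval_fps \<phi> F - peval_fps \<phi> G"
  "peval_fps \<phi> (F * G) = peval_fps \<phi> F * peval_fps \<phi> G"
  "peval_fps \<phi> (numeral k) = numeral k" "peval_fps \<phi> 1 = 1" "peval_fps \<phi> fps_X = fps_X"
  "peval_fps \<phi> (fps_const p) = fps_const (peval \<phi> p)"
  by (auto simp: fps_eq_iff fps_numeral_nth fps_X_def fps_mult_nth)

lemma peval_fps_power [simp]: "peval_fps \<phi> (F ^ n) = peval_fps \<phi> F ^ n"
  by (induction n) auto

definition fps_in :: "indet set \<Rightarrow> dpoly fps \<Rightarrow> bool" where
  "fps_in V F \<longleftrightarrow> (\<forall>n. indets (F $ n) \<subseteq> V)"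

lemma fps_in_intros:
  "fps_in V F \<Longrightarrow> fps_in V G \<Longrightarrow> fps_in V (F + G)"
  "fps_in V F \<Longrightarrow> fps_in V G \<Longrightarrow> fps_in V (F - G)"
  "fps_in V F \<Longrightarrow> fps_in V G \<Longrightarrow> fps_in V (F * G)"
  "fps_in V F \<Longrightarrow> fps_in V (F ^ 2)"
  "fps_in V (numeral k)" "fps_in V 1" "fps_in V fps_X"
  "indets p \<subseteq> V \<Longrightarrow> fps_in V (fps_const p)"
  "fps_in V F \<Longrightarrow> range Jet \<subseteq> V \<Longrightarrow> fps_in V (D_fps F)"
proof -
  show m: "fps_in V (F * G)" if "fps_in V F" "fps_in V G" for F G
    unfolding fps_in_def fps_mult_nth
    by (intro allI order.trans[OF indets_sum] UN_least order.trans[OF indets_mult])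
      (use that in \<open>auto simp: fps_in_def\<close>)
  show "fps_in V F \<Longrightarrow> fps_in V (F ^ 2)" using m[of F F] by (simp add: power2_eq_square)
  show "fps_in V F \<Longrightarrow> fps_in V G \<Longrightarrow> fps_in V (F + G)"
    unfolding fps_in_def fps_add_nth using indets_add by blast
  show "fps_in V F \<Longrightarrow> fps_in V G \<Longrightarrow> fps_in V (F - G)"
    unfolding fps_in_def fps_sub_nth using indets_diff by blast
  show "fps_in V F \<Longrightarrow> range Jet \<subseteq> V \<Longrightarrow> fps_in V (D_fps F)"
    unfolding fps_in_def D_fps_nth using indets_D by blast
qed (use indets_dconst[of 1] in \<open>auto simp: fps_in_def fps_numeral_nth fps_X_def\<close>)

section \<open>The curve series\<close>

text \<open>The factor \<xi> removes the pole. The derivatives are separate arguments so that the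
  same formula applies after evaluation at a point and after scaling.\<close>

definition curve_fps :: "'a::comm_ring_1 \<Rightarrow> 'a fps \<Rightarrow> 'a fps \<Rightarrow> 'a fps \<Rightarrow> 'a fps" where
  "curve_fps u W W1 W2 = fps_X * (W1 ^ 2 + 2 * W2 * (2 - W))
     + 4 * (1 + fps_const u * fps_X) * (2 - W) ^ 2"

abbreviation curve :: "dpoly fps \<Rightarrow> dpoly fps" where
  "curve W \<equiv> curve_fps (indet (Jet 0)) W (D_fps W) (D_fps (D_fps W))"

text \<open>Multiplication by \<xi> shifts the index by one. The assumption is there because
  \<open>curve\<close> has \<open>Jet 0\<close> where \<open>curve_series\<close> has
  \<open>w 1\<close>.\<close>

lemma curve_series_nth:
  assumes "w 1 = indet (Jet 0)"
  shows "fls_nth (curve_series w) (int k) = curve (Abs_fps w) $ Suc k"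
proof -
  let ?W = "Abs_fps w"
  have D1: "Abs_fps (\<lambda>i. D (w i)) = D_fps ?W" and D2: "Abs_fps (\<lambda>i. D (D (w i))) = D_fps (D_fps ?W)"
    by (simp_all add: fps_eq_iff)
  have X: "fls_X_inv * fls_X = (1 :: dpoly fls)"
    by (simp add: fls_X_inv_times_conv_shift)
  have cancel: "fls_X_inv * (fls_X * A + 4 * (1 + c * fls_X) * B) = A + 4 * (fls_X_inv + c) * B"
    for A B c :: "dpoly fls"
  proof -
    have "fls_X_inv * (fls_X * A + 4 * (1 + c * fls_X) * B)
        = (fls_X_inv * fls_X) * A + 4 * (fls_X_inv + c * (fls_X_inv * fls_X)) * B"
      by (simp only: distrib_left distrib_right ac_simps mult_1_left)
    then show ?thesis by (simp add: X)
  qed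
  have "fps_to_fls (curve ?W) = fls_X * (fps_to_fls (D_fps ?W) ^ 2
        + 2 * fps_to_fls (D_fps (D_fps ?W)) * (2 - fps_to_fls ?W))
      + 4 * (1 + fls_const (indet (Jet 0)) * fls_X) * (2 - fps_to_fls ?W) ^ 2"
    by (simp add: curve_fps_def fls_times_fps_to_fls fps_to_fls_power)
  then have "curve_series w = fls_X_inv * fps_to_fls (curve ?W)"
    by (simp only: cancel curve_series_def xi_series_def D1 D2 assms)
  then show ?thesis
    by (simp add: fls_X_inv_times_conv_shift nat_add_distrib)
qed

lemma peval_curve:
  "peval_fps \<phi> (curve W) = curve_fps (\<phi> (Jet 0)) (peval_fps \<phi> W)
     (peval_fps \<phi> (D_fps W)) (peval_fps \<phi> (D_fps (D_fps W)))"
  by (simp add: curve_fps_def)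

lemma curve_in: "fps_in V W \<Longrightarrow> range Jet \<subseteq> V \<Longrightarrow> fps_in V (curve W)"
  unfolding curve_fps_def by (intro fps_in_intros) auto

text \<open>The expression is homogeneous of degree 2 in \<open>2 - W\<close>, \<open>W1\<close> and
  \<open>W2\<close>. This allows passing between solutions with different constants.\<close>

lemma curve_fps_scale:
  "curve_fps u (2 - c * F) (c * W1) (c * W2) = c ^ 2 * curve_fps u (2 - F) W1 W2"
  by (simp add: curve_fps_def power2_eq_square algebra_simps)

text \<open>Here and below, indices are one higher than in the context, because \<^const>\<open>curve_fps\<close> is
  \<open>\<xi>\<close> times the series whose coefficients are compared with \<open>4 \<mu>\<^sub>k\<close>.\<close>

lemma curve_split:
  assumes "W $ 0 = 0"
  shows "curve W $ Suc k = curve (fps_cutoff (Suc k) W) $ Suc k - 16 * W $ Suc k"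
proof -
  define T where "T = fps_cutoff (Suc k) W"
  define R where "R = fps_shift (Suc k) W"
  define Y :: "dpoly fps" where "Y = fps_X ^ Suc k"
  have W: "W = T + Y * R"
    unfolding T_def R_def Y_def by (metis add.commute fps_shift_cutoff')
  have "D_fps (fps_X ^ n) = 0" for n
    by (induction n) (simp_all add: D_fps_mult)
  then have Y: "D_fps (Y * F) = Y * D_fps F" for F
    by (simp add: D_fps_mult Y_def del: power_Suc)
  \<comment> \<open>\<open>A\<close> and \<open>B\<close> sort the quotient of
    \<open>curve W - curve T\<close> by \<open>Y\<close> according to an extra factor \<xi>. Only
    the constant coefficient of \<open>B\<close> counts in degree \<open>Suc k\<close>; it is
    \<open>4 * (-4) * R $ 0\<close>.\<close>
  define A where "A = 2 * D_fps T * D_fps R + Y * D_fps R ^ 2 + 2 * D_fps (D_fps R) * (2 - T - Y * R)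
      - 2 * D_fps (D_fps T) * R"
  define B where "B = 4 * (1 + fps_const (indet (Jet 0)) * fps_X) * (Y * R ^ 2 - 2 * (2 - T) * R)"
  have "curve W = curve T + Y * (fps_X * A + B)"
    unfolding curve_fps_def W D_fps_simps Y A_def B_def
    by (simp add: power2_eq_square algebra_simps)
  then have "curve W $ Suc k = curve T $ Suc k + (fps_X * A + B) $ 0"
    by (simp add: Y_def fps_X_power_mult_nth del: power_Suc)
  moreover have "Y $ 0 = 0" "T $ 0 = 0" "R $ 0 = W $ Suc k"
    using assms by (simp_all add: Y_def T_def R_def)
  ultimately show ?thesis
    by (simp add: T_def[symmetric] B_def fps_numeral_nth)
qed

lemma curve_0: "W $ 0 = 0 \<Longrightarrow> curve W $ 0 = 16"
  by (simp add: curve_fps_def power2_eq_square fps_numeral_nth)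

text \<open>The coefficient is \<open>16 * indet (Jet 0) - 16 * W $ 1\<close>. Its vanishing matches
  the missing constant term of \<mu>.\<close>

lemma curve_1: "W $ 0 = 0 \<Longrightarrow> W $ 1 = indet (Jet 0) \<Longrightarrow> curve W $ 1 = 0"
  by (simp add: curve_fps_def power2_eq_square fps_numeral_nth fps_mult_nth_1 algebra_simps)

section \<open>The derivative of the curve series and the KdV recursion\<close>

definition kdv_op :: "dpoly fps \<Rightarrow> dpoly fps" where
  "kdv_op W = fps_X * D_fps (D_fps (D_fps W)) + 2 * fps_X * fps_const (indet (Jet 1)) * (2 - W)
     - 4 * (1 + fps_const (indet (Jet 0)) * fps_X) * D_fps W"

text \<open>The two products of first and second derivatives cancel, and every remaining term has
  the factor \<open>2 * (2 - W)\<close>.\<close>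

lemma D_curve: "D_fps (curve W) = 2 * (2 - W) * kdv_op W"
  by (simp add: curve_fps_def kdv_op_def D_fps_mult D_fps_power2 power2_eq_square algebra_simps)

lemma kdv_op_0: "W $ 0 = 0 \<Longrightarrow> kdv_op W $ 0 = 0"
  by (simp add: kdv_op_def fps_numeral_nth)

text \<open>The 2 in \<open>2 - W\<close> contributes only to degree 1, which
  \<open>k \<ge> 1\<close> excludes.\<close>

lemma kdv_op_Suc: "k \<ge> 1 \<Longrightarrow> kdv_op W $ Suc k = D (D (D (W $ k)))
   - 2 * indet (Jet 1) * W $ k - 4 * indet (Jet 0) * D (W $ k) - 4 * D (W $ Suc k)"
proof -
  assume k: "k \<ge> 1"
  have eq: "kdv_op W = fps_X * (D_fps (D_fps (D_fps W)) + fps_const (indet (Jet 1)) * (2 * (2 - W))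
      - fps_const (indet (Jet 0)) * (4 * D_fps W)) - 4 * D_fps W"
    by (simp add: kdv_op_def algebra_simps)
  have nth: "(2 * F) $ n = 2 * F $ n" "(4 * F) $ n = 4 * F $ n" for F :: "dpoly fps" and n
    by (simp_all add: numeral_fps_const)
  show ?thesis
    unfolding eq using k by (simp add: nth fps_numeral_nth)
qed

lemma kdv_op_eq_0:
  assumes "D_fps (curve W) = 0" "W $ 0 = 0"
  shows "kdv_op W = 0"
proof (rule fps_unit_cancel_all)
  show "2 * (2 - W) * kdv_op W = 0" using assms(1) by (simp add: D_curve)
  have "(4 :: dpoly) * dconst (1/4) = 1"
    unfolding dconst_simps(3)[symmetric] dconst_hom(2)[symmetric] by simp
  then show "(2 * (2 - W)) $ 0 * dconst (1/4) = 1"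
    using assms(2) by (simp add: fps_numeral_nth)
qed

text \<open>This is a coefficient of \<open>kdv_op W = 0\<close> divided by 4. It is the recursion
  of \<open>r_kdv\<close> with \<open>W $ k\<close> as antiderivative of
  \<open>D (W $ k)\<close>.\<close>

lemma kdv_recursion:
  assumes "D_fps (curve W) = 0" "W $ 0 = 0" "k \<ge> 1"
  shows "D (W $ Suc k) = dconst (1/4) * D (D (D (W $ k))) - dconst (1/2) * indet (Jet 1) * W $ k
    - indet (Jet 0) * D (W $ k)"
proof -
  have "4 * D (W $ Suc k) = D (D (D (W $ k))) - 2 * indet (Jet 1) * W $ k
      - 4 * indet (Jet 0) * D (W $ k)"
    using kdv_op_Suc[OF assms(3), of W] kdv_op_eq_0[OF assms(1,2)] by (simp add: algebra_simps)
  then have "dconst (1/4) * (4 * D (W $ Suc k)) = dconst (1/4) * (D (D (D (W $ k))) - 2 * indet (Jet 1) * W $ k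
      - 4 * indet (Jet 0) * D (W $ k))" by simp
  moreover have c: "dconst (1/4) * 4 = 1" "dconst (1/4) * 2 = dconst (1/2)"
    unfolding dconst_simps(3)[symmetric] dconst_hom(2)[symmetric] by simp_all
  have "dconst (1/4) * (4 * p) = p" "dconst (1/4) * (2 * p) = dconst (1/2) * p" for p
    using c by (simp_all flip: mult.assoc)
  ultimately show ?thesis
    by (simp add: right_diff_distrib mult.assoc)
qed

section \<open>The universal solution and the KdV recursion\<close>

definition Theta_fps :: "dpoly fps" where
  "Theta_fps = Abs_fps Theta"

text \<open>The formal counterpart of \<open>\<xi>\<mu>(\<xi>)/4\<close>, with infinitely many
  parameters; the factor \<xi> explains the shift to \<open>Par (n - 1)\<close>.\<close>

definition par_fps :: "dpoly fps" where
  "par_fps = Abs_fps (\<lambda>n. if n = 0 then 1 else if n = 1 then 0 else dconst (1/4) * indet (Par (n - 1)))"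

lemma Theta_fps_nth [simp]: "Theta_fps $ n = Theta n"
  by (simp add: Theta_fps_def)

lemma cutoff_Theta: "Abs_fps (\<lambda>i. if i \<le> k then Theta i else 0) = fps_cutoff (Suc k) Theta_fps"
  by (auto simp: fps_eq_iff)

lemma Theta_Suc_Suc:
  "Theta (Suc (Suc k)) = dconst (1/16) *
     (curve (fps_cutoff (Suc (Suc k)) Theta_fps) $ Suc (Suc k) - 4 * indet (Par (Suc k)))"
proof -
  have "fls_nth (curve_series (\<lambda>i. if i \<le> Suc k then Theta i else 0)) (int (Suc k))
      = curve (Abs_fps (\<lambda>i. if i \<le> Suc k then Theta i else 0)) $ Suc (Suc k)"
    by (rule curve_series_nth) simp
  then show ?thesis by (simp only: Theta.simps(3) cutoff_Theta)
qed

lemma dconst_mult_numeral: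
  "numeral n * dconst (1 / numeral n) = 1" "dconst (1 / numeral n) * numeral n = 1"
  unfolding dconst_simps(3)[symmetric] dconst_hom(2)[symmetric] by simp_all

text \<open>\<open>Theta\<close> was obtained by solving this equation for the coefficient that
  \<open>curve_split\<close> isolates.\<close>

lemma curve_Theta_Suc: "curve Theta_fps $ Suc (Suc k) = 4 * indet (Par (Suc k))"
proof -
  have "16 * Theta (Suc (Suc k)) = (16 * dconst (1/16)) *
     (curve (fps_cutoff (Suc (Suc k)) Theta_fps) $ Suc (Suc k) - 4 * indet (Par (Suc k)))"
    unfolding Theta_Suc_Suc by (simp only: mult.assoc)
  then show ?thesis
    using curve_split[of Theta_fps "Suc k"] by (simp add: dconst_mult_numeral)
qed

lemma curve_Theta: "curve Theta_fps = 16 * par_fps"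
proof (rule fps_ext)
  fix n
  consider "n = 0" | "n = 1" | k where "n = Suc (Suc k)"
    by (cases n; cases "n - 1") auto
  then show "curve Theta_fps $ n = (16 * par_fps) $ n"
  proof cases
    case 3
    have "16 * dconst (1/4) = 4 * (4 * dconst (1/4))" by simp
    then have "16 * dconst (1/4) = 4" by (simp only: dconst_mult_numeral mult_1_right)
    then show ?thesis
      by (simp add: 3 curve_Theta_Suc par_fps_def numeral_fps_const flip: mult.assoc)
  qed (simp_all add: curve_0 curve_1[unfolded One_nat_def] par_fps_def numeral_fps_const)
qed

lemma D_par_fps [simp]: "D_fps par_fps = 0"
  by (auto simp: fps_eq_iff par_fps_def D_mult)

text \<open>A solution normalized by \<open>\<mu>\<^sub>k = 0\<close> for all \<open>k\<close>. Since the factor \<open>b\<close> relating it to the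
  universal one satisfies \<open>\<partial>\<^sub>x b = 0\<close>, its coefficients are the integration constants that
  distinguish the two.\<close>

lemma normalized_solution:
  obtains b W where "b ^ 2 = par_fps" "b $ 0 = 1" "b $ 1 = 0" "D_fps b = 0" "curve W = 16"
    "W $ 0 = 0" "W $ 1 = indet (Jet 0)" "2 - Theta_fps = b * (2 - W)"
proof -
  obtain b where b: "b ^ 2 = par_fps" "b $ 0 = 1"
    using fps_sqrt_exists[of "dconst (1/2)" par_fps] dconst_mult_numeral(1)[of "num.Bit0 num.One"]
    by (auto simp: par_fps_def)
  have cancel2: "x = 0" if "2 * x = 0" for x :: dpoly
  proof -
    have "(dconst (1/2) * 2) * x = 0" using that by (simp only: mult.assoc mult_zero_right)
    then show ?thesis by (simp only: dconst_mult_numeral mult_1_left)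
  qed
  \<comment> \<open>The vanishing of \<open>b $ 1\<close> keeps \<open>W $ 1\<close> equal to
    \<open>Jet 0\<close> and later accounts for the missing \<open>r_kdv (g - 1)\<close> in the
    equation.\<close>
  have "2 * b $ 1 = par_fps $ 1"
    unfolding b(1)[symmetric] using b(2) by (simp add: power2_eq_square fps_mult_nth_1)
  then have b1: "b $ 1 = 0" using cancel2 by (simp add: par_fps_def)
  have Db: "D_fps b = 0"
  proof (rule fps_unit_cancel_all)
    show "2 * b * D_fps b = 0" unfolding D_fps_power2[symmetric] b(1) by simp
    show "(2 * b) $ 0 * dconst (1/2) = 1"
      using b(2) by (simp add: fps_numeral_nth dconst_mult_numeral)
  qed
  define c where "c = fps_right_inverse b 1"
  have bc: "b * c = 1" unfolding c_def by (rule fps_right_inverse) (use b in simp)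
  have c0: "c $ 0 = 1" using arg_cong[OF bc, of "\<lambda>f. f $ 0"] b(2) by simp
  have c1: "c $ 1 = 0" using arg_cong[OF bc, of "\<lambda>f. f $ 1"] b(2) b1 c0 by (simp add: fps_mult_nth_1)
  have Dc: "D_fps c = 0"
  proof (rule fps_unit_cancel_all)
    show "b * D_fps c = 0" using arg_cong[OF bc, of D_fps] Db by (simp add: D_fps_mult)
    show "b $ 0 * 1 = 1" using b(2) by simp
  qed
  \<comment> \<open>Division of \<open>2 - Theta_fps\<close> by \<open>b\<close> divides its curve
    series, \<open>16 * b ^ 2\<close>, by \<open>b ^ 2\<close>.\<close>
  define W where "W = 2 - c * (2 - Theta_fps)"
  have D1: "D_fps W = c * D_fps Theta_fps"
    by (simp add: W_def D_fps_mult Dc)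
  have D2: "D_fps (D_fps W) = c * D_fps (D_fps Theta_fps)"
    by (simp add: D1 D_fps_mult Dc)
  have "curve W = c ^ 2 * curve Theta_fps"
    unfolding D2 unfolding D1 unfolding W_def curve_fps_scale by simp
  also have "\<dots> = 16 * (b * c) ^ 2"
    by (simp add: curve_Theta b(1)[symmetric] power_mult_distrib)
  finally have "curve W = 16" by (simp add: bc)
  moreover have "W $ 0 = 0" "W $ 1 = indet (Jet 0)"
    using c0 c1 by (simp_all add: W_def fps_numeral_nth fps_mult_nth_1)
  moreover have "b * (2 - W) = (b * c) * (2 - Theta_fps)" by (simp add: W_def mult.assoc)
  then have "2 - Theta_fps = b * (2 - W)" by (simp add: bc)
  ultimately show ?thesis using b b1 Db that by blast
qed

text \<open>The right-hand side 16 brings in no parameter, so the recursion given by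
  \<open>curve_split\<close> stays among the jets.\<close>

lemma normalized_indets:
  assumes W: "curve W = 16" "W $ 0 = 0" "W $ 1 = indet (Jet 0)"
  shows "indets (W $ n) \<subseteq> range Jet"
proof (induction n rule: less_induct)
  case (less n)
  consider "n = 0" | "n = 1" | k where "n = Suc (Suc k)"
    by (cases n; cases "n - 1") auto
  then show ?case
  proof cases
    case 3
    have "16 * W $ n = curve (fps_cutoff n W) $ n"
      using curve_split[OF W(2), of "Suc k"] W(1) by (simp add: 3 fps_numeral_nth)
    then have "(dconst (1/16) * 16) * W $ n = dconst (1/16) * curve (fps_cutoff n W) $ n"
      by (simp only: mult.assoc)
    then have "W $ n = dconst (1/16) * curve (fps_cutoff n W) $ n"
      by (simp only: dconst_mult_numeral mult_1_left)
    moreover have "fps_in (range Jet) (fps_cutoff n W)"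
      using less by (simp add: fps_in_def)
    then have "fps_in (range Jet) (curve (fps_cutoff n W))" by (rule curve_in) simp
    ultimately show ?thesis
      using indets_mult[of "dconst (1/16)" "curve (fps_cutoff n W) $ n"] by (auto simp: fps_in_def)
  qed (use W in auto)
qed

text \<open>When all jets are 0, the derivatives drop out and the equation becomes
  \<open>4 * (2 - V) ^ 2 = 16\<close>. So \<open>V\<close> is 0 or 4, and \<open>V $ 0 = 0\<close>
  decides.\<close>

lemma normalized_constant_coeff:
  assumes W: "curve W = 16" "W $ 0 = 0"
  shows "Poly_Mapping.lookup (W $ n) 0 = 0"
proof -
  let ?V = "peval_fps (\<lambda>_. 0) W"
  have D: "peval_fps (\<lambda>_. 0) (D_fps F) = 0" for F by (simp add: fps_eq_iff)
  have "4 * ((4 - ?V) * ?V) = 16 - curve_fps 0 ?V 0 0"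
    by (simp add: curve_fps_def power2_eq_square algebra_simps)
  also have "\<dots> = 0"
    using peval_curve[of "\<lambda>_. 0" W] W(1) by (simp add: D)
  finally have "(4 - ?V) * ?V = 0" by (metis mult_eq_0_iff zero_neq_numeral)
  moreover have "(4 - ?V) $ 0 = 4" using W(2) by (simp add: fps_numeral_nth)
  then have "4 - ?V \<noteq> 0" by (metis fps_zero_nth zero_neq_numeral)
  ultimately have "?V = 0" by simp
  then show ?thesis
    unfolding lookup_0_eq_peval by (metis fps_zero_nth peval_fps_nth)
qed

text \<open>Inductively \<open>W $ Suc k\<close> meets the three conditions characterizing
  \<open>D_inv (r_kdv k)\<close>, which also shows that this antiderivative exists. Then
  \<open>kdv_recursion\<close> gives the next step.\<close>

lemma r_kdv_eq_D:
  assumes W: "curve W = 16" "W $ 0 = 0" "W $ 1 = indet (Jet 0)"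
  shows "r_kdv k = D (W $ Suc k)"
proof (induction k)
  case 0
  show ?case using W(3) by simp
next
  case (Suc k)
  have inv: "D_inv (r_kdv k) = W $ Suc k"
    using Suc.IH normalized_indets[OF W] normalized_constant_coeff[OF W(1,2)] by (intro D_inv_eq) auto
  have "D_fps (curve W) = 0" by (simp add: W(1))
  from kdv_recursion[OF this W(2), of "Suc k"] show ?case
    by (simp add: inv[unfolded Suc.IH] Suc.IH)
qed

text \<open>The constants \<open>a\<^sub>g\<^sub>-\<^sub>i\<close> of the equation are the coefficients of \<open>(\<mu>(\<xi>) \<xi> / 4)\<^sup>1\<^sup>/\<^sup>2\<close>: this is
  where the formula for \<open>\<mu>\<^sub>k\<close> comes from.\<close>

lemma sqrt_par_coeff:
  assumes b: "b ^ 2 = par_fps" "b $ 0 = 1"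
    and \<phi>: "\<And>k. k \<in> {1..<g} \<Longrightarrow>
      \<phi> (Par k) = 8 * a (g-k-1) + 4 * (\<Sum>i=1..k-2. a (g-i-1) * a (g-k+i))"
    and i: "2 \<le> i" "i \<le> g"
  shows "peval \<phi> (b $ i) = a (g - i)"
proof -
  define \<alpha> where "\<alpha> = Abs_fps (\<lambda>i. if i = 0 then 1 else if i = 1 then 0 else a (g - i))"
  define \<beta> where "\<beta> = peval_fps \<phi> b"
  \<comment> \<open>The formula for \<open>Par k\<close> is given only for \<open>k < g\<close>, so
    the squares are compared up to degree \<open>g\<close>.\<close>
  have sq: "(\<beta> ^ 2) $ k = (\<alpha> ^ 2) $ k" if k: "k \<le> g" for k
  proof -
    have \<beta>: "(\<beta> ^ 2) $ k = peval \<phi> (par_fps $ k)"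
      unfolding \<beta>_def b(1)[symmetric] by (simp flip: peval_fps_power)
    consider "k = 0" | "k = 1" | n where "k = Suc (Suc n)"
      by (cases k; cases "k - 1") auto
    then show ?thesis
    proof cases
      case 1
      show ?thesis
        unfolding \<beta> by (simp add: 1 par_fps_def \<alpha>_def power2_eq_square)
    next
      case 2
      show ?thesis
        unfolding \<beta> by (simp add: 2 par_fps_def \<alpha>_def power2_eq_square fps_mult_nth)
    next
      case (3 n)
      have "(\<alpha> ^ 2) $ k = (\<Sum>i=0..k. \<alpha> $ i * \<alpha> $ (k - i))"
        by (simp add: power2_eq_square fps_mult_nth)
      \<comment> \<open>Since \<open>\<alpha> $ 1 = 0\<close>, the indices 1 and
        \<open>k - 1\<close> drop out; they coincide for \<open>k = 2\<close>.\<close>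
      also have "{0..k} = insert 0 (insert k (insert 1 (insert (k - 1) {2..k-2})))"
        using 3 by auto
      also have "(\<Sum>i\<in>\<dots>. \<alpha> $ i * \<alpha> $ (k - i)) =
          (\<Sum>i\<in>insert 0 (insert k {2..k-2}). \<alpha> $ i * \<alpha> $ (k - i))"
        using 3 by (intro sum.mono_neutral_right) (auto simp: \<alpha>_def)
      also have "\<dots> = 2 * a (g - k) + (\<Sum>i=2..k-2. \<alpha> $ i * \<alpha> $ (k - i))"
        using 3 by (simp add: \<alpha>_def)
      also have "(\<Sum>i=2..k-2. \<alpha> $ i * \<alpha> $ (k - i)) = (\<Sum>i=2..k-2. a (g - i) * a (g - k + i))"
        using 3 k by (intro sum.cong) (auto simp: \<alpha>_def)
      \<comment> \<open>The parameter in degree \<open>k\<close> is \<open>Par (k - 1)\<close>,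
        hence the upper end \<open>k - 3\<close> instead of \<open>k - 2\<close>.\<close>
      also have "\<dots> = (\<Sum>i=1..k-3. a (g - i - 1) * a (g - (k - 1) + i))"
        using 3 k by (intro sum.reindex_bij_witness[of _ Suc "\<lambda>i. i - 1"]) (auto simp: Suc_diff_Suc)
      finally have "4 * (\<alpha> ^ 2) $ k = \<phi> (Par (k - 1))"
        using \<phi>[of "k - 1"] 3 k by (simp add: numeral_3_eq_3)
      then show ?thesis unfolding \<beta> using 3 by (simp add: par_fps_def mult.commute)
    qed
  qed
  \<comment> \<open>In \<open>\<beta> ^ 2 - \<alpha> ^ 2\<close> the factor
    \<open>\<beta> + \<alpha>\<close> has constant coefficient 2 and can be cancelled up to degree
    \<open>g\<close>.\<close>
  have "(\<beta> - \<alpha>) $ i = 0"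
  proof (rule fps_unit_cancel[where n = g])
    show "(\<beta> + \<alpha>) $ 0 * (1/2) = 1" by (simp add: \<beta>_def \<alpha>_def b(2))
    have "(\<beta> + \<alpha>) * (\<beta> - \<alpha>) = \<beta> ^ 2 - \<alpha> ^ 2" by (simp add: power2_eq_square algebra_simps)
    then show "((\<beta> + \<alpha>) * (\<beta> - \<alpha>)) $ k = 0" if "k \<le> g" for k
      using sq[OF that] by simp
  qed (use i in simp)
  then show ?thesis using i by (simp add: \<beta>_def \<alpha>_def)
qed

text \<open>As \<open>D_fps b = 0\<close>, differentiating
  \<open>2 - Theta_fps = b * (2 - W)\<close> gives the sum of \<open>b $ i * r_kdv (g - i)\<close>
  in degree \<open>Suc g\<close>. Here \<open>b $ 0 = 1\<close>, \<open>b $ 1 = 0\<close>, and the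
  other \<open>b $ i\<close> evaluate to \<open>a (g - i)\<close>.\<close>

lemma peval_D_Theta_Suc:
  assumes "g \<ge> 1"
    and \<phi>: "\<And>k. k \<in> {1..<g} \<Longrightarrow>
      \<phi> (Par k) = 8 * a (g-k-1) + 4 * (\<Sum>i=1..k-2. a (g-i-1) * a (g-k+i))"
  shows "peval \<phi> (D (Theta (Suc g))) = peval \<phi> (r_kdv g) + (\<Sum>k<g-1. a k * peval \<phi> (r_kdv k))"
proof -
  obtain b W where b: "b ^ 2 = par_fps" "b $ 0 = 1" "b $ 1 = 0" "D_fps b = 0" and W: "curve W = 16"
    "W $ 0 = 0" "W $ 1 = indet (Jet 0)" and bW: "2 - Theta_fps = b * (2 - W)"
    by (rule normalized_solution)
  have "D_fps Theta_fps = - D_fps (2 - Theta_fps)" by simp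
  also have "\<dots> = b * D_fps W" unfolding bW by (simp add: D_fps_mult b(4))
  finally have "D (Theta (Suc g)) = (b * D_fps W) $ Suc g" by (metis D_fps_nth Theta_fps_nth)
  also have "\<dots> = (\<Sum>i=0..g. b $ i * D (W $ (Suc g - i)))"
    by (simp add: fps_mult_nth W(2))
  also have "\<dots> = (\<Sum>i=0..g. b $ i * r_kdv (g - i))"
    by (intro sum.cong refl) (simp add: r_kdv_eq_D[OF W] Suc_diff_le)
  also have "{0..g} = insert 0 (insert 1 {2..g})" using assms(1) by auto
  finally have "peval \<phi> (D (Theta (Suc g))) =
      peval \<phi> (r_kdv g) + (\<Sum>i=2..g. peval \<phi> (b $ i) * peval \<phi> (r_kdv (g - i)))"
    using b by simp
  also have "(\<Sum>i=2..g. peval \<phi> (b $ i) * peval \<phi> (r_kdv (g - i)))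
      = (\<Sum>i=2..g. a (g - i) * peval \<phi> (r_kdv (g - i)))"
  proof (intro sum.cong refl)
    fix i assume "i \<in> {2..g}"
    then show "peval \<phi> (b $ i) * peval \<phi> (r_kdv (g - i)) = a (g - i) * peval \<phi> (r_kdv (g - i))"
      using sqrt_par_coeff[OF b(1,2) \<phi>, of i] by simp
  qed
  also have "\<dots> = (\<Sum>k<g-1. a k * peval \<phi> (r_kdv k))"
    by (intro sum.reindex_bij_witness[of _ "\<lambda>k. g - k" "\<lambda>i. g - i"]) auto
  finally show ?thesis .
qed

lemma indets_r_kdv: "indets (r_kdv k) \<subseteq> range Jet"
proof -
  obtain b W where W: "curve W = 16" "W $ 0 = 0" "W $ 1 = indet (Jet 0)"
    by (rule normalized_solution)
  show ?thesis
    unfolding r_kdv_eq_D[OF W] using indets_D normalized_indets[OF W] by blast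
qed

section \<open>The truncated series\<close>

definition trunc_Theta :: "nat \<Rightarrow> dpoly fps" where
  "trunc_Theta g = fps_cutoff (Suc g) Theta_fps"

lemma trunc_Theta_nth [simp]: "trunc_Theta g $ i = (if i \<le> g then Theta i else 0)"
  by (auto simp: trunc_Theta_def)

text \<open>\<open>Theta (Suc k)\<close> adds only \<open>Par k\<close>, so up to index
  \<open>g\<close> just the parameters prescribed by the equation occur.\<close>

lemma indets_Theta: "i \<le> g \<Longrightarrow> indets (Theta i) \<subseteq> range Jet \<union> Par ` {1..<g}"
proof (induction i rule: less_induct)
  case (less n)
  let ?V = "range Jet \<union> Par ` {1..<g}"
  consider "n = 0" | "n = 1" | k where "n = Suc (Suc k)"
    by (cases n; cases "n - 1") auto
  then show ?case
  proof cases
    case 3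
    have "fps_in ?V (fps_cutoff n Theta_fps)"
      using less by (simp add: fps_in_def)
    then have "fps_in ?V (curve (fps_cutoff n Theta_fps))" by (rule curve_in) simp
    then have "indets (curve (fps_cutoff n Theta_fps) $ n) \<subseteq> ?V" by (simp add: fps_in_def)
    moreover have "Par (Suc k) \<in> Par ` {1..<g}"
      using less.prems 3 by (intro imageI) simp
    ultimately show ?thesis
      unfolding 3 Theta_Suc_Suc
      by (intro order.trans[OF indets_mult] Un_least order.trans[OF indets_diff]) auto
  qed auto
qed

lemma indets_curve_trunc: "indets (curve (trunc_Theta g) $ n) \<subseteq> range Jet \<union> Par ` {1..<g}"
proof -
  have "fps_in (range Jet \<union> Par ` {1..<g}) (trunc_Theta g)"
    using indets_Theta by (simp add: fps_in_def)
  then show ?thesis using curve_in by (simp add: fps_in_def)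
qed

text \<open>In degrees up to \<open>g\<close> the truncation is not noticed.\<close>

lemma curve_trunc_low:
  assumes "k \<in> {1..<g}"
  shows "curve (trunc_Theta g) $ Suc k = 4 * indet (Par k)"
proof -
  have "fps_cutoff (Suc k) (trunc_Theta g) = fps_cutoff (Suc k) Theta_fps"
    using assms by (auto simp: fps_eq_iff)
  then have "curve (trunc_Theta g) $ Suc k = curve Theta_fps $ Suc k"
    using curve_split[of "trunc_Theta g" k] curve_split[of Theta_fps k] assms by simp
  then show ?thesis using curve_Theta_Suc[of "k - 1"] assms by simp
qed

text \<open>For \<open>k \<ge> 1\<close>, degree \<open>Suc k\<close> involves only the coefficients
  \<open>k\<close> and \<open>Suc k\<close>, and those of \<open>Theta_fps\<close> give 0.
  Truncation matters only at \<open>k = g\<close>, where the term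
  \<open>- 4 * D (Theta (Suc g))\<close> is lost.\<close>

lemma kdv_op_trunc:
  assumes "g \<ge> 1"
  shows "kdv_op (trunc_Theta g) = fps_const (4 * D (Theta (Suc g))) * fps_X ^ Suc g"
proof (rule fps_ext)
  fix n
  have Theta: "kdv_op Theta_fps = 0"
    by (rule kdv_op_eq_0) (simp_all add: curve_Theta D_fps_mult)
  show "kdv_op (trunc_Theta g) $ n = (fps_const (4 * D (Theta (Suc g))) * fps_X ^ Suc g) $ n"
  proof (cases n)
    case (Suc k)
    consider "k = 0" | "1 \<le> k" "k < g" | "k = g" | "k > g" by linarith
    then show ?thesis
    proof cases
      case 1
      then show ?thesis
        using assms by (simp add: Suc kdv_op_def fps_numeral_nth fps_mult_nth_1[unfolded One_nat_def]
            fps_X_power_nth del: power_Suc)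
    next
      case 2
      then show ?thesis
        using kdv_op_Suc[of k "trunc_Theta g"] kdv_op_Suc[of k Theta_fps] Theta
        by (simp add: Suc fps_X_power_nth del: power_Suc)
    next
      case 3
      then show ?thesis
        using kdv_op_Suc[of k "trunc_Theta g"] kdv_op_Suc[of k Theta_fps] Theta assms
        by (simp add: Suc fps_X_power_nth del: power_Suc)
    next
      case 4
      then show ?thesis
        using kdv_op_Suc[of k "trunc_Theta g"] assms by (simp add: Suc fps_X_power_nth del: power_Suc)
    qed
  qed (simp add: kdv_op_0)
qed

lemma peval_D_curve_trunc:
  assumes "g \<ge> 1" "peval \<phi> (D (Theta (Suc g))) = 0"
  shows "peval \<phi> (D (curve (trunc_Theta g) $ n)) = 0"
proof -
  have "peval_fps \<phi> (D_fps (curve (trunc_Theta g))) = 0"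
    by (simp add: D_curve kdv_op_trunc[OF assms(1)] assms(2) del: power_Suc)
  then show ?thesis by (metis D_fps_nth fps_zero_nth peval_fps_nth)
qed

section \<open>Evaluation along a function\<close>

text \<open>A connected set with more than one point has no isolated points. This makes derivatives
  along \<open>S\<close> unique.\<close>

lemma x_domain_at_within_neq_bot:
  assumes "x_domain S" "x \<in> S"
  shows "at x within S \<noteq> bot"
proof -
  have "S \<noteq> {z}" for z
  proof
    assume S: "S = {z}"
    consider "open S" | I :: "real set" where "open I" "S = complex_of_real ` I"
      using assms(1) by (auto simp: x_domain_def)
    then show False
    proof cases
      case 2
      then have "card I = card {z}" unfolding S[symmetric] by (simp add: card_image inj_on_def)
      then obtain t where "I = {t}" by (auto simp: card_1_singleton_iff)
      then show False using 2 not_open_singleton by blast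
    qed (use S not_open_singleton in blast)
  qed
  then have "x islimpt S"
    using assms connected_imp_perfect[of S x] by (auto simp: x_domain_def)
  then show ?thesis by (simp add: trivial_limit_within)
qed

lemma deriv_on_eq:
  assumes "x_domain S" "x \<in> S" "(f has_field_derivative d) (at x within S)"
  shows "deriv_on S f x = d"
  unfolding deriv_on_def
  using assms(3) has_field_derivative_unique[OF _ assms(3) x_domain_at_within_neq_bot[OF assms(1,2)]]
  by (rule the_equality)

text \<open>A real interval is not open in the complex plane; there convexity replaces
  openness.\<close>

lemma x_domain_derivative_zero_const:
  assumes S: "x_domain S" and f: "\<And>x. x \<in> S \<Longrightarrow> (f has_field_derivative 0) (at x within S)"
    and xy: "x \<in> S" "y \<in> S"
  shows "f x = f y"
proof -
  consider "open S" | I :: "real set" where "open I" "S = complex_of_real ` I"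
    using S by (auto simp: x_domain_def)
  then have "\<exists>c. \<forall>x\<in>S. f x = c"
  proof cases
    case 1
    have "continuous_on S f"
      using DERIV_continuous_on[of S f "\<lambda>_. 0"] f by blast
    moreover have "connected S" using S by (simp add: x_domain_def)
    ultimately show ?thesis
      using DERIV_zero_connected_constant[of S "{}" f] 1 f at_within_open by (metis DiffD1 finite.emptyI)
  next
    case 2
    have "I = Re ` S" using 2 by (auto simp: image_image)
    moreover have "connected (Re ` S)"
      using S by (intro connected_continuous_image continuous_intros) (auto simp: x_domain_def)
    ultimately have "convex I" by (simp add: is_interval_convex_1 flip: is_interval_connected_1)
    then have "convex S"
      unfolding 2 by (intro convex_linear_image bounded_linear.linear[OF bounded_linear_of_real])
    then show ?thesis using f by (intro has_field_derivative_zero_constant)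
  qed
  then show ?thesis using xy by metis
qed

text \<open>Formal and actual differentiation both obey the sum and product rules, so they need only
  be compared on generators.\<close>

lemma peval_jet_has_derivative:
  assumes "x_domain S" "smooth_fun_on S f" "x \<in> S"
  shows "((\<lambda>x. peval (jet_val S f \<mu> x) p) has_field_derivative peval (jet_val S f \<mu> x) (D p))
    (at x within S)"
proof (induction p rule: dpoly_induct)
  case (indet v)
  show ?case
  proof (cases v)
    case (Jet n)
    have "(deriv_on S ^^ n) f field_differentiable (at x within S)"
      using assms by (simp add: smooth_fun_on_def)
    then obtain d where d: "((deriv_on S ^^ n) f has_field_derivative d) (at x within S)"
      by (auto simp: field_differentiable_def)
    then have "(deriv_on S ^^ Suc n) f x = d"
      using deriv_on_eq[OF assms(1,3)] by simp
    with d show ?thesis by (simp add: Jet jet_val_def)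
  qed (simp add: jet_val_def)
next
  case (add p q)
  then show ?case by (simp add: DERIV_add)
next
  case (mult p q)
  then show ?case
    using DERIV_mult[OF mult] by (simp add: D_mult algebra_simps)
qed simp

definition trunc_val ::
  "nat \<Rightarrow> complex set \<Rightarrow> (complex \<Rightarrow> complex) \<Rightarrow> (nat \<Rightarrow> complex) \<Rightarrow> complex \<Rightarrow> nat \<Rightarrow> complex \<Rightarrow> complex" where
  "trunc_val g S f \<mu> \<xi> n x = (\<Sum>i=1..g. peval (jet_val S f \<mu> x) ((D ^^ n) (Theta i)) * \<xi> ^ i)"

lemma trunc_val_has_derivative:
  assumes "x_domain S" "smooth_fun_on S f" "x \<in> S"
  shows "(trunc_val g S f \<mu> \<xi> n has_field_derivative trunc_val g S f \<mu> \<xi> (Suc n) x) (at x within S)"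
  unfolding trunc_val_def[abs_def]
  by (intro DERIV_sum DERIV_cmult_right) (use peval_jet_has_derivative[OF assms] in simp)

lemma bold_u_derivs:
  assumes "x_domain S" "smooth_fun_on S f" "x \<in> S"
  shows "bold_u g S f \<mu> \<xi> x = trunc_val g S f \<mu> \<xi> 0 x"
    and "deriv_on S (bold_u g S f \<mu> \<xi>) x = trunc_val g S f \<mu> \<xi> 1 x"
    and "deriv_on S (deriv_on S (bold_u g S f \<mu> \<xi>)) x = trunc_val g S f \<mu> \<xi> 2 x"
proof -
  have b: "bold_u g S f \<mu> \<xi> = trunc_val g S f \<mu> \<xi> 0"
    by (simp add: fun_eq_iff bold_u_def trunc_val_def)
  then show "bold_u g S f \<mu> \<xi> x = trunc_val g S f \<mu> \<xi> 0 x" by simp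
  have d1: "deriv_on S (bold_u g S f \<mu> \<xi>) y = trunc_val g S f \<mu> \<xi> 1 y" if "y \<in> S" for y
    unfolding b using deriv_on_eq[OF assms(1) that] trunc_val_has_derivative[OF assms(1,2) that] by force
  then show "deriv_on S (bold_u g S f \<mu> \<xi>) x = trunc_val g S f \<mu> \<xi> 1 x" using assms(3) .
  \<comment> \<open>The first derivative is known only on \<open>S\<close>, which is enough for a
    derivative within \<open>S\<close>.\<close>
  have "(deriv_on S (bold_u g S f \<mu> \<xi>) has_field_derivative trunc_val g S f \<mu> \<xi> (Suc 1) x) (at x within S)"
    by (rule has_field_derivative_transform_within[OF trunc_val_has_derivative[OF assms] zero_less_one assms(3)])
      (simp add: d1)
  then show "deriv_on S (deriv_on S (bold_u g S f \<mu> \<xi>)) x = trunc_val g S f \<mu> \<xi> 2 x"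
    using deriv_on_eq[OF assms(1,3)] by (metis Suc_1)
qed

text \<open>Multiplication by the indeterminate makes both sides agree at 0 as well.\<close>

lemma poly_eq_iff_nonzero:
  fixes p q :: "complex poly"
  shows "p = q \<longleftrightarrow> (\<forall>z. z \<noteq> 0 \<longrightarrow> poly p z = poly q z)"
proof
  assume eq: "\<forall>z. z \<noteq> 0 \<longrightarrow> poly p z = poly q z"
  have "poly ([:0, 1:] * p) = poly ([:0, 1:] * q)"
  proof
    show "poly ([:0, 1:] * p) z = poly ([:0, 1:] * q) z" for z
      using eq by (cases "z = 0") auto
  qed
  then have "[:0, 1:] * p = [:0, 1:] * q" by (simp only: poly_eq_poly_eq_iff)
  then show "p = q" by simp
qed simp

text \<open>At a fixed point \<open>x\<close>, the identity of functions of \<open>\<xi>\<close> is an identity of polynomials after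
  multiplication by \<open>\<xi>\<close>, hence equivalent to the equality of all coefficients.\<close>

lemma curve_identity_iff:
  assumes S: "x_domain S" "smooth_fun_on S f" "x \<in> S" and g: "g \<ge> 1"
  shows "(\<forall>\<xi>. \<xi> \<noteq> 0 \<longrightarrow> 4 * mu_fun g \<mu> \<xi> =
          (deriv_on S (bold_u g S f \<mu> \<xi>) x)\<^sup>2
          + 2 * deriv_on S (deriv_on S (bold_u g S f \<mu> \<xi>)) x * (2 - bold_u g S f \<mu> \<xi> x)
          + 4 * (1 / \<xi> + f x) * (2 - bold_u g S f \<mu> \<xi> x)\<^sup>2)
    \<longleftrightarrow> (\<forall>k\<in>{1..2*g}. peval (jet_val S f \<mu> x) (curve (trunc_Theta g) $ Suc k) = 4 * \<mu> k)"
proof -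
  define \<phi> where "\<phi> = jet_val S f \<mu> x"
  have \<phi>0: "\<phi> (Jet 0) = f x" by (simp add: \<phi>_def jet_val_def)
  define P where "P n = (\<Sum>i=1..g. monom (peval \<phi> ((D ^^ n) (Theta i))) i)" for n
  have poly_P: "poly (P n) \<xi> = trunc_val g S f \<mu> \<xi> n x" for n \<xi>
    by (simp add: P_def trunc_val_def poly_sum poly_monom \<phi>_def)
  have D0: "(D ^^ n) 0 = 0" for n by (induction n) auto
  have coeff_P: "poly.coeff (P n) i = peval \<phi> ((D ^^ n) (trunc_Theta g $ i))" for n i
    by (cases i) (auto simp: P_def coeff_sum D0)
  have deg_P: "degree (P n) \<le> g" for n
    by (rule degree_le) (simp add: coeff_P D0)
  \<comment> \<open>\<open>C\<close> and \<open>Q\<close> are \<xi> times the right-hand and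
    left-hand sides of the identity.\<close>
  define C where "C = [:0, 1:] * (P 1 ^ 2 + 2 * P 2 * (2 - P 0)) + 4 * [:1, f x:] * (2 - P 0) ^ 2"
  define Q where "Q = 16 + (\<Sum>i=1..2*g. monom (4 * \<mu> i) (Suc i))"
  have "fps_of_poly (P 0) = peval_fps \<phi> (trunc_Theta g)"
    "fps_of_poly (P 1) = peval_fps \<phi> (D_fps (trunc_Theta g))"
    "fps_of_poly (P 2) = peval_fps \<phi> (D_fps (D_fps (trunc_Theta g)))"
    by (simp_all add: fps_eq_iff coeff_P numeral_2_eq_2 del: trunc_Theta_nth)
  moreover have "fps_of_poly [:1, f x:] = 1 + fps_const (f x) * fps_X"
    by (rule fps_of_poly_linear')
  ultimately have "fps_of_poly C = peval_fps \<phi> (curve (trunc_Theta g))"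
    unfolding C_def peval_curve unfolding curve_fps_def \<phi>0
    by (simp only: fps_of_poly_add fps_of_poly_mult fps_of_poly_diff fps_of_poly_power
        fps_of_poly_numeral fps_of_poly_fps_X)
  then have coeff_C: "poly.coeff C k = peval \<phi> (curve (trunc_Theta g) $ k)" for k
    by (metis fps_of_poly_nth peval_fps_nth)
  have deg2: "degree (2 - P 0) \<le> g" using deg_P[of 0] by (intro degree_diff_le) simp_all
  have "degree C \<le> 2 * g + 1"
    unfolding C_def
  proof (intro degree_add_le)
    have "degree (P 1 ^ 2) \<le> 2 * g" "degree (2 * P 2 * (2 - P 0)) \<le> 2 * g"
      using degree_power_le[of "P 1" 2] degree_mult_le[of "2 * P 2" "2 - P 0"]
        degree_mult_le[of 2 "P 2"] deg_P[of 1] deg_P[of 2] deg2 by simp_all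
    then have "degree (P 1 ^ 2 + 2 * P 2 * (2 - P 0)) \<le> 2 * g" by (rule degree_add_le)
    then show "degree ([:0, 1:] * (P 1 ^ 2 + 2 * P 2 * (2 - P 0))) \<le> 2 * g + 1"
      using degree_mult_le[of "[:0, 1:]" "P 1 ^ 2 + 2 * P 2 * (2 - P 0)"] by simp
    have "degree (4 * [:1, f x:]) \<le> 1"
      using degree_mult_le[of 4 "[:1, f x:]"] by (auto split: if_splits)
    then show "degree (4 * [:1, f x:] * (2 - P 0) ^ 2) \<le> 2 * g + 1"
      using degree_mult_le[of "4 * [:1, f x:]" "(2 - P 0) ^ 2"] degree_power_le[of "2 - P 0" 2] deg2
      by linarith
  qed
  then have C_high: "poly.coeff C k = 0" if "k > 2 * g + 1" for k
    using that by (intro coeff_eq_0) simp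
  have coeff_Q: "poly.coeff Q k = (if k = 0 then 16 else if k \<in> {2..2*g+1} then 4 * \<mu> (k - 1) else 0)" for k
  proof -
    have "poly.coeff Q k = poly.coeff 16 k + (\<Sum>i=1..2*g. if Suc i = k then 4 * \<mu> i else 0)"
      by (simp add: Q_def coeff_sum)
    also have "(\<Sum>i=1..2*g. if Suc i = k then 4 * \<mu> i else 0)
        = (\<Sum>i=1..2*g. if i = k - 1 then (if k = 0 then 0 else 4 * \<mu> (k - 1)) else 0)"
      by (intro sum.cong refl) auto
    finally show ?thesis by (cases k) (auto simp: numeral_poly)
  qed
  \<comment> \<open>The coefficients in degrees 0, 1 and above \<open>2 * g + 1\<close> agree for
    every choice of \<mu>.\<close>
  have "C = Q \<longleftrightarrow> (\<forall>k\<in>{1..2*g}. poly.coeff C (Suc k) = 4 * \<mu> k)"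
  proof
    assume "C = Q"
    then show "\<forall>k\<in>{1..2*g}. poly.coeff C (Suc k) = 4 * \<mu> k" by (simp add: coeff_Q)
  next
    assume eq: "\<forall>k\<in>{1..2*g}. poly.coeff C (Suc k) = 4 * \<mu> k"
    show "C = Q"
    proof (rule poly_eqI)
      fix k
      consider "k = 0" | "k = 1" | "k \<in> {2..2*g+1}" | "k > 2 * g + 1" by fastforce
      then show "poly.coeff C k = poly.coeff Q k"
      proof cases
        case 1
        then show ?thesis by (simp add: coeff_C coeff_Q curve_0)
      next
        case 2
        have "curve (trunc_Theta g) $ 1 = 0" using g by (intro curve_1) simp_all
        then show ?thesis by (simp add: 2 coeff_C coeff_Q)
      next
        case 3
        then have "k - 1 \<in> {1..2*g}" "Suc (k - 1) = k" by auto
        with eq have "poly.coeff C k = 4 * \<mu> (k - 1)" by metis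
        then show ?thesis using 3 by (simp add: coeff_Q)
      next
        case 4
        then show ?thesis by (simp add: C_high coeff_Q)
      qed
    qed
  qed
  also have "C = Q \<longleftrightarrow> (\<forall>\<xi>. \<xi> \<noteq> 0 \<longrightarrow> poly C \<xi> = poly Q \<xi>)" by (rule poly_eq_iff_nonzero)
  also have "\<dots> \<longleftrightarrow> (\<forall>\<xi>. \<xi> \<noteq> 0 \<longrightarrow> 4 * mu_fun g \<mu> \<xi> =
          (deriv_on S (bold_u g S f \<mu> \<xi>) x)\<^sup>2
          + 2 * deriv_on S (deriv_on S (bold_u g S f \<mu> \<xi>)) x * (2 - bold_u g S f \<mu> \<xi> x)
          + 4 * (1 / \<xi> + f x) * (2 - bold_u g S f \<mu> \<xi> x)\<^sup>2)"
    (is "_ \<longleftrightarrow> (\<forall>\<xi>. \<xi> \<noteq> 0 \<longrightarrow> ?l \<xi> = ?r \<xi>)")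
  proof (intro all_cong1 imp_cong refl)
    fix \<xi> :: complex assume \<xi>: "\<xi> \<noteq> 0"
    have "poly C \<xi> = \<xi> * ?r \<xi>"
      unfolding bold_u_derivs[OF S] C_def using \<xi> by (simp add: poly_P algebra_simps)
    moreover have "poly Q \<xi> = \<xi> * ?l \<xi>"
      using \<xi> by (simp add: Q_def mu_fun_def poly_sum poly_monom distrib_left sum_distrib_left ac_simps)
    ultimately show "(poly C \<xi> = poly Q \<xi>) = (?l \<xi> = ?r \<xi>)" using \<xi> by auto
  qed
  finally show ?thesis unfolding coeff_C \<phi>_def .
qed

lemma peval_jet_Par_cong:
  assumes "indets p \<subseteq> range Jet \<union> Par ` {1..<g}" "\<And>k. k \<in> {1..<g} \<Longrightarrow> \<mu> k = \<nu> k"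
  shows "peval (jet_val S f \<mu> x) p = peval (jet_val S f \<nu> x) p"
  by (rule peval_cong) (use assms in \<open>auto simp: jet_val_def\<close>)

section \<open>Existence, uniqueness and values of the constants\<close>

theorem corollary4p1:
  fixes g :: nat and a :: "nat \<Rightarrow> complex"
    and S :: "complex set" and u1 :: "complex \<Rightarrow> complex"
  assumes "g \<ge> 1"
    and "x_domain S"
    and "smooth_fun_on S u1"
    and "stationary_kdv g a S u1"
  shows "(\<exists>!(\<Gamma>, \<mu>). \<Gamma> = spectral_curve g \<mu> \<and> curve_data g a S u1 \<mu>) \<and>
    (\<forall>\<mu>. curve_data g a S u1 \<mu> \<longrightarrow>
      (\<forall>t\<^sub>0\<in>S. \<forall>k\<in>{g..2*g}.
         4 * \<mu> k = peval (jet_val S u1 (\<lambda>j. if j \<in> {1..<g} then \<mu> j else 0) t\<^sub>0)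
           (fls_nth (curve_series (\<lambda>i. if i \<le> g then Theta i else 0)) (int k))))"
proof -
  note ass = assms
  define m where "m k = 8 * a (g-k-1) + 4 * (\<Sum>i=1..k-2. a (g-i-1) * a (g-k+i))" for k
  define c where "c k x = peval (jet_val S u1 m x) (curve (trunc_Theta g) $ Suc k)" for k x
  \<comment> \<open>Only parameters below \<open>g\<close> enter these coefficients, so the
    constants still to be found do not occur in the expressions that determine them.\<close>
  have c_eq: "peval (jet_val S u1 \<nu> x) (curve (trunc_Theta g) $ Suc k) = c k x"
    if "\<And>k. k \<in> {1..<g} \<Longrightarrow> \<nu> k = m k" for \<nu> k x
    unfolding c_def by (rule peval_jet_Par_cong[OF indets_curve_trunc that])
  have c_low: "c k x = 4 * m k" if "k \<in> {1..<g}" for k x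
    using curve_trunc_low[OF that] by (simp add: c_def jet_val_def)
  \<comment> \<open>Each \<open>\<mu> k\<close> with \<open>k \<ge> g\<close> gets its own equation,
    so solvability means that \<open>c k\<close> is constant on \<open>S\<close>.\<close>
  have data_iff: "curve_data g a S u1 \<mu> \<longleftrightarrow> (\<forall>k. k \<notin> {1..2*g} \<longrightarrow> \<mu> k = 0) \<and>
      (\<forall>k\<in>{1..<g}. \<mu> k = m k) \<and> (\<forall>x\<in>S. \<forall>k\<in>{g..2*g}. c k x = 4 * \<mu> k)" for \<mu>
  proof -
    have low: "(\<forall>k\<in>{1..2*g}. peval (jet_val S u1 \<mu> x) (curve (trunc_Theta g) $ Suc k) = 4 * \<mu> k)
        \<longleftrightarrow> (\<forall>k\<in>{g..2*g}. c k x = 4 * \<mu> k)" if \<mu>: "\<forall>k\<in>{1..<g}. \<mu> k = m k" for x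
    proof -
      have "{1..2*g} = {1..<g} \<union> {g..2*g}" using ass(1) by auto
      then show ?thesis using c_eq[of \<mu>] c_low \<mu> by (simp add: ball_Un)
    qed
    have "curve_data g a S u1 \<mu> \<longleftrightarrow> (\<forall>k. k \<notin> {1..2*g} \<longrightarrow> \<mu> k = 0) \<and> (\<forall>k\<in>{1..<g}. \<mu> k = m k) \<and>
        (\<forall>x\<in>S. \<forall>k\<in>{1..2*g}. peval (jet_val S u1 \<mu> x) (curve (trunc_Theta g) $ Suc k) = 4 * \<mu> k)"
      unfolding curve_data_def m_def
      by (intro conj_cong refl ball_cong curve_identity_iff ass)
    also have "\<dots> \<longleftrightarrow> (\<forall>k. k \<notin> {1..2*g} \<longrightarrow> \<mu> k = 0) \<and> (\<forall>k\<in>{1..<g}. \<mu> k = m k) \<and>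
        (\<forall>x\<in>S. \<forall>k\<in>{g..2*g}. c k x = 4 * \<mu> k)"
      by (intro conj_cong refl) (simp only: low)
    finally show ?thesis .
  qed
  obtain t where t: "t \<in> S" using ass(2) by (auto simp: x_domain_def)
  have const: "c k x = c k t" if "x \<in> S" for k x
  proof (rule x_domain_derivative_zero_const[OF ass(2) _ that t])
    fix y assume y: "y \<in> S"
    \<comment> \<open>\<open>stationary_kdv\<close> sets all parameters to 0, which is harmless
      because \<open>r_kdv j\<close> contains none. The bound 0 below makes the set of parameters to
      compare empty.\<close>
    have "peval (jet_val S u1 m y) (r_kdv j) = peval (jet_val S u1 (\<lambda>_. 0) y) (r_kdv j)" for j
      by (rule peval_jet_Par_cong[of _ 0]) (use indets_r_kdv[of j] in auto)
    then have "peval (jet_val S u1 m y) (D (Theta (Suc g))) = 0"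
      using peval_D_Theta_Suc[of g "jet_val S u1 m y" a] ass(1,4) y
      by (simp add: jet_val_def m_def stationary_kdv_def)
    then have "peval (jet_val S u1 m y) (D (curve (trunc_Theta g) $ Suc k)) = 0"
      by (rule peval_D_curve_trunc[OF ass(1)])
    then show "(c k has_field_derivative 0) (at y within S)"
      using peval_jet_has_derivative[OF ass(2,3) y, of m "curve (trunc_Theta g) $ Suc k"]
      by (simp add: c_def[abs_def])
  qed
  define \<mu> where "\<mu> k = (if k \<in> {1..<g} then m k else if k \<in> {g..2*g} then c k t / 4 else 0)" for k
  have \<mu>: "curve_data g a S u1 \<mu>"
    unfolding data_iff using ass(1) const by (auto simp: \<mu>_def)
  \<comment> \<open>The equations at the single point \<open>t\<close> already fix all entries from
    \<open>g\<close> on.\<close>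
  have unique: "\<nu> = \<mu>" if "curve_data g a S u1 \<nu>" for \<nu>
  proof
    fix k
    have "k \<in> {1..<g} \<or> k \<in> {g..2*g} \<or> k \<notin> {1..2*g}" by auto
    then show "\<nu> k = \<mu> k"
      using that \<mu> t unfolding data_iff by (metis mult_cancel_left zero_neq_numeral)
  qed
  have "\<exists>!(\<Gamma>, \<mu>). \<Gamma> = spectral_curve g \<mu> \<and> curve_data g a S u1 \<mu>"
  proof (rule ex1I[of _ "(spectral_curve g \<mu>, \<mu>)"])
    show "case (spectral_curve g \<mu>, \<mu>) of
        (\<Gamma>, \<mu>) \<Rightarrow> \<Gamma> = spectral_curve g \<mu> \<and> curve_data g a S u1 \<mu>"
      using \<mu> by simp
  next
    fix p
    assume p: "case p of (\<Gamma>, \<mu>) \<Rightarrow> \<Gamma> = spectral_curve g \<mu> \<and> curve_data g a S u1 \<mu>"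
    obtain \<Gamma> \<nu> where \<Gamma>\<nu>: "p = (\<Gamma>, \<nu>)" by (rule prod.exhaust)
    with p have "\<Gamma> = spectral_curve g \<nu>" "curve_data g a S u1 \<nu>" by simp_all
    with unique[of \<nu>] show "p = (spectral_curve g \<mu>, \<mu>)" by (simp only: \<Gamma>\<nu>)
  qed
  moreover have "4 * \<mu> k = peval (jet_val S u1 (\<lambda>j. if j \<in> {1..<g} then \<mu> j else 0) x)
       (fls_nth (curve_series (\<lambda>i. if i \<le> g then Theta i else 0)) (int k))"
    if "x \<in> S" "k \<in> {g..2*g}" for x k
  proof -
    have "fls_nth (curve_series (\<lambda>i. if i \<le> g then Theta i else 0)) (int k)
        = curve (trunc_Theta g) $ Suc k"
      using curve_series_nth[of "\<lambda>i. if i \<le> g then Theta i else 0" k] ass(1)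
      by (simp add: cutoff_Theta trunc_Theta_def)
    moreover have "peval (jet_val S u1 (\<lambda>j. if j \<in> {1..<g} then \<mu> j else 0) x)
        (curve (trunc_Theta g) $ Suc k) = c k x"
      by (rule c_eq) (simp add: \<mu>_def)
    moreover have "c k x = 4 * \<mu> k" using \<mu> that unfolding data_iff by blast
    ultimately show ?thesis by simp
  qed
  ultimately show ?thesis using unique by blast
qed

end
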